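(* There exists a constant $K>0$ such that every solution $\mathbf{u}$ of the Cauchy problem (KPP)--(IC) satisfies \[ u_i(t,x)\leq K+\sup_{y\in\mathbb{R}^n}\max_{j\in[N]}u_{\mathrm{ini},j}(y)\quad\text{for all }i\in[N],\ (t,x)\in[0,+\infty)\times\mathbb{R}^n, \] and \[ \limsup_{t\to+\infty}\sup_{x\in\mathbb{R}^n}\max_{i\in[N]}u_i(t,x)\leq K. \]
   Context: Setting. Let $N,n\geq 1$ be integers, $[N]=\{1,\dots,N\}$, and fix $T,L_1,\dots,L_n>0$. "Periodic" means $T$-periodic in $t$ and $L_\alpha$-periodic in $x_\alpha$ for each $\alpha\in[n]$. For each $i\in[N]$ let $A_i:\mathbb{R}\times\mathbb{R}^n\to\mathbb{R}^{n\times n}$ (symmetric) and $q_i:\mathbb{R}\times\mathbb{R}^n\to\mathbb{R}^n$, and let $\mathbf{L}=(l_{i,j}),\mathbf{C}=(c_{i,j}):\mathbb{R}\times\mathbb{R}^n\to\mathbb{R}^{N\times N}$, all periodic, with some $\delta\in(0,1)$ such that $\mathbf{L},\mathbf{C},q_i$ are $\delta/2$-Hölder in $t$ and $\delta$-Hölder in $x$, and $A_i$ is $\delta/2$-Hölder in $t$ and $C^{1+\delta}$ in $x$. Standing assumptions: (i) $\min_{i}\inf_{|y|=1}\inf_{(t,x)}y\cdot A_i(t,x)y>0$; (ii) for $i\neq j$, $\min_{(t,x)}l_{i,j}\geq 0$; (iii) the matrix $(\max_{(t,x)}l_{i,j}(t,x))_{i,j}$ is irreducible (leaves invariant no coordinate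 subspace $\mathrm{span}(\mathbf{e}_{i_1},\dots,\mathbf{e}_{i_k})$, $1\leq k\leq N-1$; $1\times1$ matrices are irreducible); (iv) $\min_{(t,x)}c_{i,j}>0$ for all $i,j$. $\mathcal{P}_iu=\partial_tu-\nabla\cdot(A_i\nabla u)+q_i\cdot\nabla u$. The system (KPP) is $\mathcal{P}_iu_i=\sum_jl_{i,j}u_j-u_i\sum_jc_{i,j}u_j$, $i\in[N]$; the Cauchy problem (KPP)--(IC) is (KPP) on $(0,+\infty)\times\mathbb{R}^n$ with $\mathbf{u}(0,\cdot)=\mathbf{u}_{\mathrm{ini}}$, $\mathbf{u}_{\mathrm{ini}}$ bounded, continuous, componentwise nonnegative. The constant $K$ may depend on the coefficients but not on $\mathbf{u}_{\mathrm{ini}}$. *)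

theory Defs
  imports "HOL-Analysis.Analysis"
begin

text \<open>Space variable x in R^n is real^'n; the N components are indexed by a finite type 'k.
  Coefficients: A i t x (n x n matrix), q i t x (vector in R^n),
  Lc t x = (l_{i,j}), Cc t x = (c_{i,j}) (N x N matrices).\<close>

definition periodic_tx :: "real \<Rightarrow> real^'n \<Rightarrow> (real \<Rightarrow> real^'n \<Rightarrow> 'b) \<Rightarrow> bool" where
  "periodic_tx T L f \<longleftrightarrow>
     (\<forall>t x. f (t + T) x = f t x) \<and>
     (\<forall>t x \<alpha>. f t (x + (L $ \<alpha>) *\<^sub>R axis \<alpha> 1) = f t x)"

text \<open>Parabolic Hoelder regularity: delta/2-Hoelder in t and delta-Hoelder in x (uniformly).\<close>
definition holder_tx :: "real \<Rightarrow> (real \<Rightarrow> real^'n \<Rightarrow> 'b::real_normed_vector) \<Rightarrow> bool" where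
  "holder_tx \<delta> f \<longleftrightarrow> (\<exists>C. \<forall>t s x y.
     norm (f t x - f s y) \<le> C * (\<bar>t - s\<bar> powr (\<delta> / 2) + norm (x - y) powr \<delta>))"

text \<open>A is delta/2-Hoelder in t and C^{1+delta} in x: A is differentiable in x, and A together
  with its partial derivatives dA t x alpha = d/dx_alpha A(t,x) are Hoelder as above.\<close>
definition holder_tx_C1 :: "real \<Rightarrow> (real \<Rightarrow> real^'n \<Rightarrow> 'b::real_normed_vector) \<Rightarrow> bool" where
  "holder_tx_C1 \<delta> f \<longleftrightarrow> holder_tx \<delta> f \<and>
     (\<exists>df :: real \<Rightarrow> real^'n \<Rightarrow> 'n \<Rightarrow> 'b.
        (\<forall>t x. (f t has_derivative (\<lambda>h. \<Sum>\<alpha>\<in>UNIV. (h $ \<alpha>) *\<^sub>R df t x \<alpha>)) (at x)) \<and>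
        (\<forall>\<alpha>. holder_tx \<delta> (\<lambda>t x. df t x \<alpha>)))"

text \<open>Irreducibility: M leaves invariant no coordinate subspace span(e_i, i in I), I nonempty proper.\<close>
definition irreducible_mat :: "real^'k^'k \<Rightarrow> bool" where
  "irreducible_mat M \<longleftrightarrow>
     (\<forall>I. I \<noteq> {} \<and> I \<noteq> UNIV \<longrightarrow>
        \<not> ((*v) M ` span ((\<lambda>i. axis i 1) ` I) \<subseteq> span ((\<lambda>i. axis i 1) ` I)))"

text \<open>Standing assumptions on the coefficients.\<close>
definition standing_assumptions ::
  "real \<Rightarrow> real^'n \<Rightarrow> ('k \<Rightarrow> real \<Rightarrow> real^'n \<Rightarrow> real^'n^'n) \<Rightarrow> ('k \<Rightarrow> real \<Rightarrow> real^'n \<Rightarrow> real^'n)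
   \<Rightarrow> (real \<Rightarrow> real^'n \<Rightarrow> real^'k^'k) \<Rightarrow> (real \<Rightarrow> real^'n \<Rightarrow> real^'k^'k) \<Rightarrow> bool" where
  "standing_assumptions T L A q Lc Cc \<longleftrightarrow>
     T > 0 \<and> (\<forall>\<alpha>. L $ \<alpha> > 0) \<and>
     (\<forall>i. periodic_tx T L (A i) \<and> periodic_tx T L (q i)) \<and>
     periodic_tx T L Lc \<and> periodic_tx T L Cc \<and>
     (\<exists>\<delta>. 0 < \<delta> \<and> \<delta> < 1 \<and> holder_tx \<delta> Lc \<and> holder_tx \<delta> Cc \<and>
        (\<forall>i. holder_tx \<delta> (q i) \<and> holder_tx_C1 \<delta> (A i))) \<and>
     (\<forall>i t x. transpose (A i t x) = A i t x) \<and>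
     (\<exists>\<mu>>0. \<forall>i t x y. norm y = 1 \<longrightarrow> y \<bullet> (A i t x *v y) \<ge> \<mu>) \<and>
     (\<forall>i j t x. i \<noteq> j \<longrightarrow> Lc t x $ i $ j \<ge> 0) \<and>
     irreducible_mat (\<chi> i j. (SUP tx. Lc (fst tx) (snd tx) $ i $ j)) \<and>
     (\<forall>i j. (INF tx. Cc (fst tx) (snd tx) $ i $ j) > 0)"

text \<open>Classical solution of the Cauchy problem (KPP)--(IC): continuous on [0,oo) x R^n,
  C^{1,2} on (0,oo) x R^n, bounded on every strip [0,T'] x R^n, with initial value u0,
  satisfying P_i u_i = sum_j l_ij u_j - u_i sum_j c_ij u_j pointwise.
  Divergence term: div(A_i grad u_i) is the trace of the x-derivative of the flux A_i grad u_i.\<close>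
definition kpp_solution ::
  "('k \<Rightarrow> real \<Rightarrow> real^'n \<Rightarrow> real^'n^'n) \<Rightarrow> ('k \<Rightarrow> real \<Rightarrow> real^'n \<Rightarrow> real^'n)
   \<Rightarrow> (real \<Rightarrow> real^'n \<Rightarrow> real^'k^'k) \<Rightarrow> (real \<Rightarrow> real^'n \<Rightarrow> real^'k^'k)
   \<Rightarrow> (real^'n \<Rightarrow> real^'k) \<Rightarrow> (real \<Rightarrow> real^'n \<Rightarrow> real^'k) \<Rightarrow> bool" where
  "kpp_solution A q Lc Cc u0 u \<longleftrightarrow>
     continuous_on ({0..} \<times> UNIV) (\<lambda>(t, x). u t x) \<and>
     (\<forall>x. u 0 x = u0 x) \<and>
     (\<forall>T'>0. bounded ((\<lambda>(t, x). u t x) ` ({0..T'} \<times> UNIV))) \<and>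
     (\<forall>i. \<exists>(ut :: real \<Rightarrow> real^'n \<Rightarrow> real) (Du :: real \<Rightarrow> real^'n \<Rightarrow> real^'n)
            (D2u :: real \<Rightarrow> real^'n \<Rightarrow> real^'n^'n) (DF :: real \<Rightarrow> real^'n \<Rightarrow> real^'n \<Rightarrow> real^'n).
        (\<forall>t>0. \<forall>x. ((\<lambda>s. u s x $ i) has_real_derivative ut t x) (at t)) \<and>
        (\<forall>t>0. \<forall>x. ((\<lambda>y. u t y $ i) has_derivative (\<lambda>h. Du t x \<bullet> h)) (at x)) \<and>
        (\<forall>t>0. \<forall>x. (Du t has_derivative (\<lambda>h. D2u t x *v h)) (at x)) \<and>
        continuous_on ({0<..} \<times> UNIV) (\<lambda>(t, x). ut t x) \<and>
        continuous_on ({0<..} \<times> UNIV) (\<lambda>(t, x). Du t x) \<and>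
        continuous_on ({0<..} \<times> UNIV) (\<lambda>(t, x). D2u t x) \<and>
        (\<forall>t>0. \<forall>x. ((\<lambda>y. A i t y *v Du t y) has_derivative DF t x) (at x)) \<and>
        (\<forall>t>0. \<forall>x.
           ut t x - (\<Sum>\<alpha>\<in>UNIV. DF t x (axis \<alpha> 1) $ \<alpha>) + q i t x \<bullet> Du t x
           = (\<Sum>j\<in>UNIV. Lc t x $ i $ j * u t x $ j) - u t x $ i * (\<Sum>j\<in>UNIV. Cc t x $ i $ j * u t x $ j)))"

end

(*
  Both bounds come from comparing u with spatially homogeneous functions of t. Since the
  off-diagonal l_ij are nonnegative, at a point where the largest component u_i is positive the
  reaction term is at most N l u_i - c u_i^2, where l bounds the l_ij and c is the minimum of the
  c_ii. Hence the logistic profile kappa + a / (1 + c a t), with kappa = N l / c and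
  kappa + a >= sup u_ini, stays above u: it is at most kappa + sup u_ini, and below kappa + 1
  once t >= 1/c. This gives the theorem with K = kappa + 1.

  The comparison is a weak maximum principle on [0,T] x R^n, proved by penalising with
  eps e^(Mt) (1 + |x|^2) so that a positive maximum is attained. There the time derivative is
  nonnegative, the gradient is a multiple of x and the Hessian is bounded by a multiple of the
  identity, so, A being positive semidefinite, tr(A D^2 u) is controlled; with the linear growth of
  the coefficients this is impossible for M large. Applied to -u the same principle first shows
  that u is nonnegative, which the upper bound for the reaction term needs.
*)
theory Submission
  imports Defs "HOL-Library.Periodic_Fun"
begin

section \<open>Positive semidefinite matrices\<close>

lemma inner_matrix_vector_commute:
  fixes A :: "real^'n^'n"
  assumes "transpose A = A"
  shows "x \<bullet> (A *v y) = y \<bullet> (A *v x)"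
  by (metis assms dot_lmul_matrix inner_commute transpose_matrix_vector)

lemma psd_Cauchy_Schwarz:
  fixes A :: "real^'n^'n"
  assumes sym: "transpose A = A" and psd: "\<And>h. 0 \<le> h \<bullet> (A *v h)"
  shows "(x \<bullet> (A *v y))\<^sup>2 \<le> (x \<bullet> (A *v x)) * (y \<bullet> (A *v y))"
proof -
  let ?a = "x \<bullet> (A *v x)" and ?b = "x \<bullet> (A *v y)" and ?c = "y \<bullet> (A *v y)"
  have quadratic_nonneg: "0 \<le> ?a + 2 * s * ?b + s\<^sup>2 * ?c" for s
  proof -
    have "0 \<le> (x + s *\<^sub>R y) \<bullet> (A *v (x + s *\<^sub>R y))" by (rule psd)
    also have "\<dots> = ?a + s * ?b + s * (y \<bullet> (A *v x)) + s\<^sup>2 * ?c"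
      by (simp add: matrix_vector_right_distrib matrix_vector_mult_scaleR inner_add_left
          inner_add_right power2_eq_square algebra_simps)
    finally show ?thesis using inner_matrix_vector_commute[OF sym, of y x] by simp
  qed
  have "0 \<le> ?c" by (rule psd)
  show ?thesis
  proof (cases "?c = 0")
    case True
    have "?b = 0"
    proof (rule ccontr)
      assume "?b \<noteq> 0"
      then have "?a + 2 * (- (?a + 1) / (2 * ?b)) * ?b = -1" by (simp add: field_simps)
      with quadratic_nonneg[of "- (?a + 1) / (2 * ?b)"] True show False by simp
    qed
    with True show ?thesis by simp
  next
    case False
    with \<open>0 \<le> ?c\<close> have "0 < ?c" by simp
    have "0 \<le> ?a + 2 * (- ?b / ?c) * ?b + (- ?b / ?c)\<^sup>2 * ?c" by (rule quadratic_nonneg)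
    also have "\<dots> = ?a - ?b\<^sup>2 / ?c" using \<open>0 < ?c\<close> by (simp add: field_simps power2_eq_square)
    finally show ?thesis using \<open>0 < ?c\<close> by (simp add: divide_le_eq mult.commute)
  qed
qed

lemma trace_matrix_mult:
  "trace ((A :: real^'n^'n) ** B) = (\<Sum>i\<in>UNIV. \<Sum>j\<in>UNIV. A$i$j * B$j$i)"
  by (simp add: trace_def matrix_matrix_mult_def)

lemma inner_matrix_vector_sum:
  "(x :: real^'n) \<bullet> (A *v y) = (\<Sum>i\<in>UNIV. \<Sum>j\<in>UNIV. x$i * A$i$j * y$j)"
  by (simp add: inner_vec_def matrix_vector_mult_def sum_distrib_left mult.assoc)

text \<open>The Schur complement of the pivot \<open>A$p$p\<close>, padded with a zero row and column \<open>p\<close>.\<close>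
definition deflate_row :: "real^'n^'n \<Rightarrow> 'n \<Rightarrow> real^'n^'n" where
  "deflate_row A p = (\<chi> i j. A$i$j - A$p$i * A$p$j / A$p$p)"

lemma psd_deflate_row:
  fixes A B :: "real^'n^'n"
  assumes sym: "transpose A = A" and psd: "\<And>h. 0 \<le> h \<bullet> (A *v h)" and pos: "0 < A$p$p"
  defines "A' \<equiv> deflate_row A p"
  shows "transpose A' = A'" and "\<And>h. 0 \<le> h \<bullet> (A' *v h)" and "\<And>j. A'$p$j = 0"
    and "trace (A ** B) = trace (A' ** B) + (A$p) \<bullet> (B *v A$p) / A$p$p"
proof -
  let ?d = "A$p$p" and ?a = "A$p"
  have symm: "A$i$j = A$j$i" for i j using sym by (metis transpose_def vec_lambda_beta)
  then show "transpose A' = A'" by (simp add: A'_def deflate_row_def transpose_def mult.commute)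
  show "A'$p$j = 0" for j using pos by (simp add: A'_def deflate_row_def)
  have row: "?a \<bullet> h = axis p 1 \<bullet> (A *v h)" for h
    unfolding inner_axis' by (simp add: matrix_vector_mult_def inner_vec_def mult.commute)
  have quad: "h \<bullet> (A' *v h) = h \<bullet> (A *v h) - (?a \<bullet> h)\<^sup>2 / ?d" for h
  proof -
    have "h \<bullet> (A' *v h) = (\<Sum>i\<in>UNIV. \<Sum>j\<in>UNIV. h$i * A$i$j * h$j - (h$i * ?a$i) * (?a$j * h$j) / ?d)"
      unfolding inner_matrix_vector_sum A'_def deflate_row_def by (intro sum.cong refl) (simp add: algebra_simps)
    also have "\<dots> = h \<bullet> (A *v h) - (\<Sum>i\<in>UNIV. \<Sum>j\<in>UNIV. (h$i * ?a$i) * (?a$j * h$j)) / ?d"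
      unfolding inner_matrix_vector_sum by (simp add: sum_subtractf sum_divide_distrib)
    also have "(\<Sum>i\<in>UNIV. \<Sum>j\<in>UNIV. (h$i * ?a$i) * (?a$j * h$j)) = (?a \<bullet> h)\<^sup>2"
      by (simp add: power2_eq_square inner_vec_def sum_product mult.commute)
    finally show ?thesis .
  qed
  show "0 \<le> h \<bullet> (A' *v h)" for h
  proof -
    have "axis p 1 \<bullet> (A *v axis p 1) = ?d"
      by (simp add: inner_axis' matrix_vector_mult_basis column_def)
    with psd_Cauchy_Schwarz[OF sym psd, of "axis p 1" h]
    have "(?a \<bullet> h)\<^sup>2 \<le> ?d * (h \<bullet> (A *v h))" unfolding row by simp
    with pos show ?thesis unfolding quad by (simp add: field_simps)
  qed
  have "trace (A ** B) = (\<Sum>i\<in>UNIV. \<Sum>j\<in>UNIV. A'$i$j * B$j$i + ?a$j * B$j$i * ?a$i / ?d)"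
    unfolding trace_matrix_mult A'_def deflate_row_def using pos symm
    by (intro sum.cong refl) (simp add: field_simps)
  also have "\<dots> = trace (A' ** B) + (\<Sum>i\<in>UNIV. \<Sum>j\<in>UNIV. ?a$j * B$j$i * ?a$i) / ?d"
    unfolding trace_matrix_mult by (simp add: sum.distrib sum_divide_distrib)
  also have "(\<Sum>i\<in>UNIV. \<Sum>j\<in>UNIV. ?a$j * B$j$i * ?a$i) = ?a \<bullet> (B *v ?a)"
    unfolding inner_matrix_vector_sum by (rule sum.swap)
  finally show "trace (A ** B) = trace (A' ** B) + ?a \<bullet> (B *v ?a) / ?d" .
qed

lemma trace_mult_psd_nsd_nonpos:
  fixes A B :: "real^'n^'n"
  assumes "transpose A = A" and "\<And>h. 0 \<le> h \<bullet> (A *v h)" and nsd: "\<And>h. h \<bullet> (B *v h) \<le> 0"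
  shows "trace (A ** B) \<le> 0"
proof -
  \<comment> \<open>Induction on the rows that may be nonzero, splitting off one Schur complement at a time.\<close>
  have "finite S \<Longrightarrow> transpose A = A \<Longrightarrow> (\<And>h. 0 \<le> h \<bullet> (A *v h)) \<Longrightarrow> (\<And>i j. i \<notin> S \<Longrightarrow> A$i$j = 0)
    \<Longrightarrow> trace (A ** B) \<le> 0" for S and A :: "real^'n^'n"
  proof (induction S arbitrary: A rule: finite_induct)
    case empty
    then show ?case by (simp add: trace_matrix_mult)
  next
    case (insert p S)
    have "0 \<le> A$p$p"
      using insert.prems(2)[of "axis p 1"] by (simp add: inner_axis' matrix_vector_mult_basis column_def)
    show ?case
    proof (cases "A$p$p = 0")
      case True
      have "A$p$j = 0" for j
        using psd_Cauchy_Schwarz[OF insert.prems(1,2), of "axis p 1" "axis j 1"] True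
          insert.prems(2)[of "axis j 1"] by (simp add: inner_axis' matrix_vector_mult_basis column_def)
      then show ?thesis using insert by (metis insertE)
    next
      case False
      with \<open>0 \<le> A$p$p\<close> have pos: "0 < A$p$p" by simp
      note deflate = psd_deflate_row[OF insert.prems(1,2) pos]
      have "deflate_row A p $ i $ j = 0" if "i \<notin> S" for i j
      proof (cases "i = p")
        case False
        with that have "A$i$j = 0" "A$p$i = 0"
          using insert.prems(1,3) by (auto, metis transpose_def vec_lambda_beta)
        then show ?thesis by (simp add: deflate_row_def)
      qed (use deflate(3) in simp)
      then have "trace (deflate_row A p ** B) \<le> 0" by (intro insert.IH deflate(1,2))
      moreover have "A$p \<bullet> (B *v A$p) / A$p$p \<le> 0" using nsd pos by (simp add: divide_nonpos_pos)
      ultimately show ?thesis using deflate(4)[of B] by linarith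
    qed
  qed
  from this[of UNIV] assms show ?thesis by simp
qed

section \<open>The parabolic operator at a maximum\<close>

lemma has_real_derivative_nonneg_at_left_max:
  fixes f :: "real \<Rightarrow> real"
  assumes "(f has_real_derivative f') (at t)" and "a < t" and "\<And>s. a < s \<Longrightarrow> s < t \<Longrightarrow> f s \<le> f t"
  shows "0 \<le> f'"
proof (rule ccontr)
  assume "\<not> 0 \<le> f'"
  then obtain d where "0 < d" and d: "\<And>h. 0 < h \<Longrightarrow> h < d \<Longrightarrow> f t < f (t - h)"
    using DERIV_neg_dec_left[OF assms(1)] by force
  let ?h = "min (d/2) ((t - a)/2)"
  have "f t < f (t - ?h)" using d \<open>0 < d\<close> assms(2) by simp
  moreover have "f (t - ?h) \<le> f t" by (rule assms(3)) (use assms(2) \<open>0 < d\<close> in \<open>auto simp: min_def field_simps\<close>)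
  ultimately show False by simp
qed

lemma gradient_hessian_at_max:
  fixes g :: "'a::real_inner \<Rightarrow> real"
  assumes max: "\<And>y. g y \<le> g x0"
    and dg: "\<And>y. (g has_derivative (\<lambda>h. W y \<bullet> h)) (at y)"
    and dW: "(W has_derivative W') (at x0)"
  shows "W x0 = 0" and "h \<bullet> W' h \<le> 0"
proof -
  have "(\<lambda>h. W x0 \<bullet> h) = (\<lambda>h. 0)"
    using differential_zero_maxmin[of x0 UNIV g, OF _ _ dg] max by auto
  then have "W x0 \<bullet> W x0 = 0" by metis
  then show W0: "W x0 = 0" by simp
  show "h \<bullet> W' h \<le> 0"
  proof (rule ccontr)
    assume "\<not> h \<bullet> W' h \<le> 0"
    define p where "p s = W (x0 + s *\<^sub>R h) \<bullet> h" for s :: real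
    have line: "((\<lambda>s. x0 + s *\<^sub>R h) has_derivative (\<lambda>s'. s' *\<^sub>R h)) (at s)" for s
      by (auto intro!: derivative_eq_intros)
    have dline: "((\<lambda>s. g (x0 + s *\<^sub>R h)) has_real_derivative p s) (at s)" for s
      using has_derivative_compose[OF line dg] unfolding has_field_derivative_def p_def o_def
      by (rule has_derivative_eq_rhs) (simp add: fun_eq_iff)
    have "((\<lambda>s. W (x0 + s *\<^sub>R h)) has_derivative (\<lambda>s'. W' (s' *\<^sub>R h))) (at 0)"
      using has_derivative_compose[OF line[of 0], of W W'] dW by (simp add: o_def)
    then have "(p has_derivative (\<lambda>s'. W' (s' *\<^sub>R h) \<bullet> h)) (at 0)"
      unfolding p_def by (auto intro!: derivative_eq_intros)
    moreover have "W' (s' *\<^sub>R h) = s' *\<^sub>R W' h" for s'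
      using has_derivative_bounded_linear[OF dW] by (simp add: bounded_linear.linear linear_cmul)
    ultimately have "(p has_real_derivative (W' h \<bullet> h)) (at 0)"
      by (simp add: has_field_derivative_def mult.commute[of _ "W' h \<bullet> h"])
    moreover have "0 < W' h \<bullet> h" using \<open>\<not> h \<bullet> W' h \<le> 0\<close> by (simp add: inner_commute)
    ultimately obtain d where "0 < d" and d: "\<And>s. 0 < s \<Longrightarrow> s < d \<Longrightarrow> p 0 < p s"
      using DERIV_pos_inc_right by force
    obtain \<xi> where "0 < \<xi>" "\<xi> < d/2" and \<xi>: "g (x0 + (d/2) *\<^sub>R h) - g (x0 + 0 *\<^sub>R h) = (d/2 - 0) * p \<xi>"
      using MVT2[of 0 "d/2" "\<lambda>s. g (x0 + s *\<^sub>R h)" p] dline \<open>0 < d\<close> by auto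
    have "0 < p \<xi>" using d[of \<xi>] \<open>0 < \<xi>\<close> \<open>\<xi> < d/2\<close> by (simp add: p_def W0)
    with \<open>0 < d\<close> have "0 < (d/2 - 0) * p \<xi>" by simp
    with \<xi> have "g x0 < g (x0 + (d/2) *\<^sub>R h)" by simp
    with max show False by (metis not_le)
  qed
qed

lemma bounded_bilinear_matrix_vector_mult:
  "bounded_bilinear ((*v) :: real^'n^'m \<Rightarrow> real^'n \<Rightarrow> real^'m)"
  unfolding bilinear_conv_bounded_bilinear[symmetric] bilinear_def
  by (auto intro!: linearI simp: matrix_vector_mult_add_rdistrib matrix_vector_right_distrib
      matrix_vector_mult_scaleR vec_eq_iff matrix_vector_mult_def sum_distrib_left mult.assoc
      sum.distrib distrib_right)

lemma abs_matrix_vector_mult_component_le: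
  "\<bar>((A :: real^'n^'m) *v x) $ i\<bar> \<le> norm A * norm x"
proof -
  have "\<bar>(A *v x) $ i\<bar> \<le> norm (A $ i) * norm x"
    by (simp add: matrix_mult_dot Cauchy_Schwarz_ineq2)
  also have "\<dots> \<le> norm A * norm x"
    by (rule mult_right_mono[OF Finite_Cartesian_Product.norm_nth_le]) simp
  finally show ?thesis .
qed

lemma divergence_product_rule:
  fixes A :: "real^'n \<Rightarrow> real^'n^'n" and V :: "real^'n \<Rightarrow> real^'n"
  assumes dA: "(A has_derivative (\<lambda>h. \<Sum>\<alpha>\<in>UNIV. h$\<alpha> *\<^sub>R dA \<alpha>)) (at x)"
    and dV: "(V has_derivative (\<lambda>h. H *v h)) (at x)"
    and dF: "((\<lambda>y. A y *v V y) has_derivative DF) (at x)"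
  shows "(\<Sum>\<alpha>\<in>UNIV. DF (axis \<alpha> 1) $ \<alpha>) = trace (A x ** H) + (\<Sum>\<alpha>\<in>UNIV. (dA \<alpha> *v V x) $ \<alpha>)"
proof -
  have DF: "DF = (\<lambda>h. A x *v (H *v h) + (\<Sum>\<alpha>\<in>UNIV. h$\<alpha> *\<^sub>R dA \<alpha>) *v V x)"
    using has_derivative_unique[OF dF bounded_bilinear.FDERIV[OF bounded_bilinear_matrix_vector_mult dA dV]] .
  have "(\<Sum>\<beta>\<in>UNIV. (axis \<alpha> 1 $ \<beta>) *\<^sub>R dA \<beta>) = dA \<alpha>" for \<alpha>
  proof -
    have "(axis \<alpha> 1 $ \<beta>) *\<^sub>R dA \<beta> = (if \<beta> = \<alpha> then dA \<beta> else 0)" for \<beta>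
      by (simp add: axis_def)
    then show ?thesis by simp
  qed
  moreover have "(A x *v (H *v axis \<alpha> 1)) $ \<alpha> = (A x ** H) $ \<alpha> $ \<alpha>" for \<alpha>
    by (simp only: matrix_vector_mul_assoc) (simp add: matrix_vector_mult_basis column_def)
  ultimately show ?thesis by (simp add: DF trace_def sum.distrib)
qed

lemma abs_matrix_entry_le_norm: "\<bar>(A :: real^'n^'m) $ i $ j\<bar> \<le> norm A"
  using component_le_norm_cart[of "A $ i" j] Finite_Cartesian_Product.norm_nth_le[of A i] by linarith

lemma trace_le_norm: "trace (A :: real^'n^'n) \<le> real CARD('n) * norm A"
proof -
  have "trace A \<le> (\<Sum>i\<in>(UNIV :: 'n set). norm A)"
    unfolding trace_def by (rule sum_mono) (metis abs_le_D1 abs_matrix_entry_le_norm)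
  then show ?thesis by simp
qed

lemma trace_scaleR: "trace (c *\<^sub>R (A :: real^'n^'n)) = c * trace A"
  by (simp add: trace_def sum_distrib_left)

lemma touching_paraboloid_conditions:
  fixes g :: "real^'n \<Rightarrow> real"
  assumes max: "\<And>y. E * g y - G * (1 + y \<bullet> y) \<le> E * g x0 - G * (1 + x0 \<bullet> x0)"
    and dg: "\<And>y. (g has_derivative (\<lambda>h. Dg y \<bullet> h)) (at y)"
    and dDg: "(Dg has_derivative (\<lambda>h. H *v h)) (at x0)"
    and sym: "transpose S = S" and psd: "\<And>h. 0 \<le> h \<bullet> (S *v h)"
  shows "E *\<^sub>R Dg x0 = (2 * G) *\<^sub>R x0" and "E * trace (S ** H) \<le> 2 * G * trace S"
proof -
  define W where "W y = E *\<^sub>R Dg y - (2 * G) *\<^sub>R y" for y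
  have "((\<lambda>y. E * g y - G * (1 + y \<bullet> y)) has_derivative (\<lambda>h. W y \<bullet> h)) (at y)" for y
  proof -
    have "((\<lambda>y. E * g y - G * (1 + y \<bullet> y)) has_derivative (\<lambda>h. E * (Dg y \<bullet> h) - G * (h \<bullet> y + y \<bullet> h))) (at y)"
      using dg[of y] by (auto intro!: derivative_eq_intros)
    then show ?thesis
      by (rule has_derivative_eq_rhs) (auto simp: fun_eq_iff W_def inner_diff_left inner_commute algebra_simps)
  qed
  moreover have "(W has_derivative (\<lambda>h. E *\<^sub>R (H *v h) - (2 * G) *\<^sub>R h)) (at x0)"
    unfolding W_def using dDg by (auto intro!: derivative_eq_intros)
  ultimately have "W x0 = 0" and nsd: "\<And>h. h \<bullet> (E *\<^sub>R (H *v h) - (2 * G) *\<^sub>R h) \<le> 0"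
    using gradient_hessian_at_max[where g = "\<lambda>y. E * g y - G * (1 + y \<bullet> y)", OF max] by blast+
  then show "E *\<^sub>R Dg x0 = (2 * G) *\<^sub>R x0" by (simp add: W_def)
  have "trace (S ** (E *\<^sub>R H + (- 2 * G) *\<^sub>R mat 1)) \<le> 0"
  proof (rule trace_mult_psd_nsd_nonpos[OF sym psd])
    show "h \<bullet> ((E *\<^sub>R H + (- 2 * G) *\<^sub>R mat 1) *v h) \<le> 0" for h
      using nsd[of h] by (simp add: matrix_vector_mult_diff_rdistrib scaleR_matrix_vector_assoc[symmetric])
  qed
  then have "E * trace (S ** H) + (- 2 * G) * trace S \<le> 0"
    by (simp only: matrix_add_ldistrib matrix_scalar_ac scalar_matrix_assoc[symmetric] trace_add
        trace_scaleR matrix_mul_rid)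
  then show "E * trace (S ** H) \<le> 2 * G * trace S" by simp
qed

lemma sum_diag_matrix_vector_le:
  fixes M :: "'n \<Rightarrow> real^'n^'n"
  assumes "\<And>\<alpha>. norm (M \<alpha>) \<le> c"
  shows "(\<Sum>\<alpha>\<in>UNIV. (M \<alpha> *v v) $ \<alpha>) \<le> real CARD('n) * (c * norm v)"
proof -
  have "(\<Sum>\<alpha>\<in>UNIV. (M \<alpha> *v v) $ \<alpha>) \<le> (\<Sum>\<alpha>\<in>(UNIV :: 'n set). c * norm v)"
  proof (rule sum_mono)
    fix \<alpha>
    have "(M \<alpha> *v v) $ \<alpha> \<le> norm (M \<alpha>) * norm v"
      by (metis abs_le_D1 abs_matrix_vector_mult_component_le)
    also have "\<dots> \<le> c * norm v" using assms by (rule mult_right_mono) simp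
    finally show "(M \<alpha> *v v) $ \<alpha> \<le> c * norm v" .
  qed
  then show ?thesis by simp
qed

lemma linear_growth_product_le:
  fixes n r :: real
  assumes "0 \<le> n" "0 \<le> r"
  shows "(1 + r) * (n + (n + 1) * r) \<le> 2 * (2 * n + 1) * (1 + r\<^sup>2)"
proof -
  have "n + (n + 1) * r \<le> (2 * n + 1) * (1 + r)" using assms by (simp add: algebra_simps)
  then have "(1 + r) * (n + (n + 1) * r) \<le> (1 + r) * ((2 * n + 1) * (1 + r))"
    using assms by (intro mult_left_mono) auto
  also have "\<dots> = (2 * n + 1) * (1 + r)\<^sup>2" by (simp add: power2_eq_square)
  also have "\<dots> \<le> (2 * n + 1) * (2 * (1 + r\<^sup>2))"
    using sum_squares_bound[of 1 r] assms by (intro mult_left_mono) (simp_all add: power2_sum)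
  finally show ?thesis by (simp add: algebra_simps)
qed

lemma elliptic_part_at_touching_point:
  fixes g :: "real^'n \<Rightarrow> real" and A :: "real^'n \<Rightarrow> real^'n^'n"
  assumes "0 < G" and max: "\<And>y. E * g y - G * (1 + y \<bullet> y) \<le> E * g x0 - G * (1 + x0 \<bullet> x0)"
    and dg: "\<And>y. (g has_derivative (\<lambda>h. Dg y \<bullet> h)) (at y)"
    and dDg: "(Dg has_derivative (\<lambda>h. H *v h)) (at x0)"
    and dA: "(A has_derivative (\<lambda>h. \<Sum>\<alpha>\<in>UNIV. h$\<alpha> *\<^sub>R dA \<alpha>)) (at x0)"
    and dF: "((\<lambda>y. A y *v Dg y) has_derivative DF) (at x0)"
    and sym: "transpose (A x0) = A x0" and psd: "\<And>h. 0 \<le> h \<bullet> (A x0 *v h)"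
    and bounds: "norm (A x0) \<le> D * (1 + norm x0)" "\<And>\<alpha>. norm (dA \<alpha>) \<le> D * (1 + norm x0)"
      "norm b \<le> D * (1 + norm x0)"
  shows "E * ((\<Sum>\<alpha>\<in>UNIV. DF (axis \<alpha> 1) $ \<alpha>) - b \<bullet> Dg x0)
    \<le> 4 * D * (2 * real CARD('n) + 1) * G * (1 + x0 \<bullet> x0)"
proof -
  let ?n = "real CARD('n)" and ?r = "norm x0"
  note touch = touching_paraboloid_conditions[OF max dg dDg sym psd]
  have "0 \<le> D"
    using order_trans[OF norm_ge_zero bounds(1)] norm_ge_zero[of x0] by (auto simp: zero_le_mult_iff)
  have "E * trace (A x0 ** H) \<le> 2 * G * (?n * (D * (1 + ?r)))"
  proof -
    have "trace (A x0) \<le> ?n * (D * (1 + ?r))"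
      using trace_le_norm[of "A x0"] bounds(1) by (smt (verit) mult_left_mono of_nat_0_le_iff)
    then show ?thesis using touch(2) \<open>0 < G\<close> by (smt (verit) mult_left_mono)
  qed
  moreover have "E * (\<Sum>\<alpha>\<in>UNIV. (dA \<alpha> *v Dg x0) $ \<alpha>) \<le> ?n * (D * (1 + ?r) * (2 * G * ?r))"
  proof -
    have "E * (\<Sum>\<alpha>\<in>UNIV. (dA \<alpha> *v Dg x0) $ \<alpha>) = (\<Sum>\<alpha>\<in>UNIV. (dA \<alpha> *v ((2 * G) *\<^sub>R x0)) $ \<alpha>)"
      by (simp add: sum_distrib_left matrix_vector_mult_scaleR flip: touch(1))
    also have "\<dots> \<le> ?n * (D * (1 + ?r) * norm ((2 * G) *\<^sub>R x0))"
      by (rule sum_diag_matrix_vector_le[OF bounds(2)])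
    finally show ?thesis using \<open>0 < G\<close> by simp
  qed
  moreover have "- (E * (b \<bullet> Dg x0)) \<le> D * (1 + ?r) * (2 * G * ?r)"
  proof -
    have "- (E * (b \<bullet> Dg x0)) = - (b \<bullet> ((2 * G) *\<^sub>R x0))"
      by (metis inner_scaleR_right touch(1))
    also have "\<dots> \<le> norm b * norm ((2 * G) *\<^sub>R x0)"
      by (metis Cauchy_Schwarz_ineq2 abs_le_D2)
    also have "\<dots> \<le> D * (1 + ?r) * (2 * G * ?r)"
      using bounds(3) \<open>0 < G\<close> \<open>0 \<le> D\<close> by (intro mult_mono) auto
    finally show ?thesis .
  qed
  ultimately have "E * ((\<Sum>\<alpha>\<in>UNIV. DF (axis \<alpha> 1) $ \<alpha>) - b \<bullet> Dg x0)
      \<le> 2 * G * D * ((1 + ?r) * (?n + (?n + 1) * ?r))"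
    unfolding divergence_product_rule[OF dA dDg dF] by (simp add: algebra_simps)
  also have "\<dots> \<le> 2 * G * D * (2 * (2 * ?n + 1) * (1 + ?r\<^sup>2))"
    using linear_growth_product_le[of ?n ?r] \<open>0 < G\<close> \<open>0 \<le> D\<close> by (intro mult_left_mono) auto
  also have "\<dots> = 4 * D * (2 * ?n + 1) * G * (1 + x0 \<bullet> x0)"
    by (simp add: power2_norm_eq_inner)
  finally show ?thesis .
qed

section \<open>A weak maximum principle for cooperative systems\<close>

lemma max_over_components_attained:
  fixes z :: "'k::finite \<Rightarrow> real \<Rightarrow> 'a::{heine_borel,real_normed_vector} \<Rightarrow> real"
  assumes cont: "\<And>j. continuous_on ({0..T} \<times> UNIV) (\<lambda>p. z j (fst p) (snd p))"
    and far: "\<And>j s y. 0 \<le> s \<Longrightarrow> s \<le> T \<Longrightarrow> R < norm y \<Longrightarrow> z j s y < 0"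
    and pos: "0 \<le> t1" "t1 \<le> T" "0 < z i1 t1 x1"
  obtains i0 t0 x0 where "0 \<le> t0" "t0 \<le> T" "0 < z i0 t0 x0"
    and "\<And>j s y. 0 \<le> s \<Longrightarrow> s \<le> T \<Longrightarrow> z j s y \<le> z i0 t0 x0"
proof -
  define S where "S = {0..T} \<times> cball (0::'a) R"
  have "(t1, x1) \<in> S" using pos far[of t1 x1 i1] by (force simp: S_def)
  have "\<exists>p\<in>S. \<forall>p'\<in>S. z j (fst p') (snd p') \<le> z j (fst p) (snd p)" for j
  proof (rule continuous_attains_sup)
    show "compact S" unfolding S_def by (intro compact_Times) auto
    show "continuous_on S (\<lambda>p. z j (fst p) (snd p))"
      by (rule continuous_on_subset[OF cont]) (auto simp: S_def)
  qed (use \<open>(t1, x1) \<in> S\<close> in auto)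
  then obtain P where P: "\<And>j. P j \<in> S"
    and P_max: "\<And>j p. p \<in> S \<Longrightarrow> z j (fst p) (snd p) \<le> z j (fst (P j)) (snd (P j))"
    by metis
  define f where "f j = z j (fst (P j)) (snd (P j))" for j
  have "Max (range f) \<in> range f" by (rule Max_in) auto
  then obtain i0 where i0: "f j \<le> f i0" for j by (metis Max_ge finite UNIV_I finite_imageI imageE rangeI)
  show ?thesis
  proof
    show "0 \<le> fst (P i0)" "fst (P i0) \<le> T" using P[of i0] by (auto simp: S_def)
    show "0 < z i0 (fst (P i0)) (snd (P i0))"
      using pos(3) P_max[OF \<open>(t1, x1) \<in> S\<close>, of i1] i0[of i1] by (simp add: f_def)
    then show "z j s y \<le> z i0 (fst (P i0)) (snd (P i0))" if "0 \<le> s" "s \<le> T" for j s y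
    proof (cases "norm y \<le> R")
      case True
      then have "(s, y) \<in> S" using that by (auto simp: S_def)
      then show ?thesis using P_max[of "(s, y)" j] i0[of j] by (simp add: f_def)
    next
      case False
      with far[OF that] have "z j s y < 0" by simp
      with \<open>0 < z i0 (fst (P i0)) (snd (P i0))\<close> show ?thesis by simp
    qed
  qed
qed

lemma penalty_dominates_far:
  fixes y :: "'a::real_inner"
  assumes "0 < \<epsilon>" and "0 \<le> M" and "0 \<le> s" "s \<le> T" and "w \<le> B"
    and far: "exp (\<bar>\<beta>\<bar> * T) * max B 0 / \<epsilon> + 1 < norm y"
  shows "exp (- \<beta> * s) * w < \<epsilon> * exp (M * s) * (1 + y \<bullet> y)"
proof -
  define B' where "B' = exp (\<bar>\<beta>\<bar> * T) * max B 0"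
  have "exp (- \<beta> * s) * w \<le> B'"
  proof (cases "w \<le> 0")
    case False
    have "- \<beta> * s \<le> \<bar>\<beta>\<bar> * s" using \<open>0 \<le> s\<close> by (intro mult_right_mono) auto
    also have "\<dots> \<le> \<bar>\<beta>\<bar> * T" using \<open>s \<le> T\<close> by (intro mult_left_mono) auto
    finally have "exp (- \<beta> * s) \<le> exp (\<bar>\<beta>\<bar> * T)" by simp
    then show ?thesis using False \<open>w \<le> B\<close> by (auto simp: B'_def intro: mult_mono)
  qed (simp add: B'_def mult_nonneg_nonpos order_trans[OF _ zero_le_mult_iff[THEN iffD2]])
  also have "B' < \<epsilon> * (norm y * norm y)"
  proof -
    have "0 \<le> B' / \<epsilon>" using \<open>0 < \<epsilon>\<close> by (simp add: B'_def)
    with far have "1 \<le> norm y" and "B' / \<epsilon> < norm y" unfolding B'_def by linarith+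
    with \<open>0 < \<epsilon>\<close> have "B' < \<epsilon> * norm y" by (simp add: field_simps)
    moreover have "norm y \<le> norm y * norm y"
      using mult_left_mono[of 1 "norm y" "norm y"] \<open>1 \<le> norm y\<close> by simp
    then have "\<epsilon> * norm y \<le> \<epsilon> * (norm y * norm y)"
      using \<open>0 < \<epsilon>\<close> by (intro mult_left_mono) auto
    ultimately show ?thesis by linarith
  qed
  also have "\<dots> \<le> \<epsilon> * (1 + y \<bullet> y)"
    using \<open>0 < \<epsilon>\<close> by (simp add: power2_norm_eq_inner[symmetric] power2_eq_square)
  also have "\<dots> \<le> \<epsilon> * exp (M * s) * (1 + y \<bullet> y)"
    using \<open>0 \<le> M\<close> \<open>0 \<le> s\<close> \<open>0 < \<epsilon>\<close> by (simp add: add_pos_nonneg)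
  finally show ?thesis .
qed

lemma penalised_subsolution_no_interior_max:
  fixes w :: "real \<Rightarrow> real^'n \<Rightarrow> real" and A :: "real^'n \<Rightarrow> real^'n^'n"
  assumes "0 < \<epsilon>" "0 < t0"
    and max_t: "\<And>s. 0 < s \<Longrightarrow> s < t0 \<Longrightarrow> exp (- \<beta> * s) * w s x0 - \<epsilon> * exp (M * s) * (1 + x0 \<bullet> x0)
      \<le> exp (- \<beta> * t0) * w t0 x0 - \<epsilon> * exp (M * t0) * (1 + x0 \<bullet> x0)"
    and max_x: "\<And>y. exp (- \<beta> * t0) * w t0 y - \<epsilon> * exp (M * t0) * (1 + y \<bullet> y)
      \<le> exp (- \<beta> * t0) * w t0 x0 - \<epsilon> * exp (M * t0) * (1 + x0 \<bullet> x0)"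
    and dt: "((\<lambda>s. w s x0) has_real_derivative wt) (at t0)"
    and dx: "\<And>y. (w t0 has_derivative (\<lambda>h. Dw y \<bullet> h)) (at y)"
    and dxx: "(Dw has_derivative (\<lambda>h. H *v h)) (at x0)"
    and dA: "(A has_derivative (\<lambda>h. \<Sum>\<alpha>\<in>UNIV. h$\<alpha> *\<^sub>R dA \<alpha>)) (at x0)"
    and dF: "((\<lambda>y. A y *v Dw y) has_derivative DF) (at x0)"
    and sym: "transpose (A x0) = A x0" and psd: "\<And>h. 0 \<le> h \<bullet> (A x0 *v h)"
    and bounds: "norm (A x0) \<le> D * (1 + norm x0)" "\<And>\<alpha>. norm (dA \<alpha>) \<le> D * (1 + norm x0)"
      "norm b \<le> D * (1 + norm x0)"
    and sub: "wt - (\<Sum>\<alpha>\<in>UNIV. DF (axis \<alpha> 1) $ \<alpha>) + b \<bullet> Dw x0 \<le> \<beta> * w t0 x0"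
  shows "M \<le> 4 * D * (2 * real CARD('n) + 1)"
proof -
  define E where "E = exp (- \<beta> * t0)"
  define G where "G = \<epsilon> * exp (M * t0)"
  have "0 < E" "0 < G" using \<open>0 < \<epsilon>\<close> by (auto simp: E_def G_def)
  have "((\<lambda>s. exp (- \<beta> * s) * w s x0 - \<epsilon> * exp (M * s) * (1 + x0 \<bullet> x0)) has_real_derivative
      E * wt - \<beta> * E * w t0 x0 - M * G * (1 + x0 \<bullet> x0)) (at t0)"
    unfolding E_def G_def using dt by (auto intro!: derivative_eq_intros simp: algebra_simps)
  from has_real_derivative_nonneg_at_left_max[OF this \<open>0 < t0\<close> max_t]
  have "M * G * (1 + x0 \<bullet> x0) \<le> E * (wt - \<beta> * w t0 x0)" by (simp add: algebra_simps)
  also have "\<dots> \<le> E * ((\<Sum>\<alpha>\<in>UNIV. DF (axis \<alpha> 1) $ \<alpha>) - b \<bullet> Dw x0)"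
    using sub \<open>0 < E\<close> by (intro mult_left_mono) auto
  also have "\<dots> \<le> 4 * D * (2 * real CARD('n) + 1) * G * (1 + x0 \<bullet> x0)"
    by (rule elliptic_part_at_touching_point[OF \<open>0 < G\<close> _ dx dxx dA dF sym psd bounds])
      (use max_x in \<open>simp add: E_def G_def\<close>)
  finally show ?thesis using \<open>0 < G\<close> by (simp add: add_pos_nonneg)
qed

text \<open>Cooperativity enters only through \<open>sub\<close>, which is needed just where a positive component is
  maximal among the components. The unbounded domain is handled by the penalisation
  \<open>\<epsilon> e\<^sup>M\<^sup>t (1 + |x|\<^sup>2)\<close>, with \<open>M\<close> exceeding the linear growth rate of the coefficients.\<close>
lemma parabolic_system_max_principle:
  fixes v :: "real \<Rightarrow> real^'n \<Rightarrow> real^'k::finite"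
    and vt :: "'k \<Rightarrow> real \<Rightarrow> real^'n \<Rightarrow> real" and Dv :: "'k \<Rightarrow> real \<Rightarrow> real^'n \<Rightarrow> real^'n"
    and D2v :: "'k \<Rightarrow> real \<Rightarrow> real^'n \<Rightarrow> real^'n^'n"
    and DF :: "'k \<Rightarrow> real \<Rightarrow> real^'n \<Rightarrow> real^'n \<Rightarrow> real^'n"
    and A :: "'k \<Rightarrow> real \<Rightarrow> real^'n \<Rightarrow> real^'n^'n" and dA :: "'k \<Rightarrow> real \<Rightarrow> real^'n \<Rightarrow> 'n \<Rightarrow> real^'n^'n"
    and q :: "'k \<Rightarrow> real \<Rightarrow> real^'n \<Rightarrow> real^'n"
  assumes cont: "\<And>i. continuous_on ({0..T} \<times> UNIV) (\<lambda>p. v (fst p) (snd p) $ i)"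
    and bdd: "\<And>i t x. 0 \<le> t \<Longrightarrow> t \<le> T \<Longrightarrow> v t x $ i \<le> B"
    and init: "\<And>i x. v 0 x $ i \<le> 0"
    and dt: "\<And>i t x. 0 < t \<Longrightarrow> t \<le> T \<Longrightarrow> ((\<lambda>s. v s x $ i) has_real_derivative vt i t x) (at t)"
    and dx: "\<And>i t x. 0 < t \<Longrightarrow> t \<le> T \<Longrightarrow> ((\<lambda>y. v t y $ i) has_derivative (\<lambda>h. Dv i t x \<bullet> h)) (at x)"
    and dxx: "\<And>i t x. 0 < t \<Longrightarrow> t \<le> T \<Longrightarrow> (Dv i t has_derivative (\<lambda>h. D2v i t x *v h)) (at x)"
    and dF: "\<And>i t x. 0 < t \<Longrightarrow> t \<le> T \<Longrightarrow> ((\<lambda>y. A i t y *v Dv i t y) has_derivative DF i t x) (at x)"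
    and dA: "\<And>i t x. (A i t has_derivative (\<lambda>h. \<Sum>\<alpha>\<in>UNIV. h$\<alpha> *\<^sub>R dA i t x \<alpha>)) (at x)"
    and sym: "\<And>i t x. transpose (A i t x) = A i t x" and psd: "\<And>i t x h. 0 \<le> h \<bullet> (A i t x *v h)"
    and "0 \<le> D"
    and A_growth: "\<And>i t x. 0 < t \<Longrightarrow> t \<le> T \<Longrightarrow> norm (A i t x) \<le> D * (1 + norm x)"
    and dA_growth: "\<And>i t x \<alpha>. 0 < t \<Longrightarrow> t \<le> T \<Longrightarrow> norm (dA i t x \<alpha>) \<le> D * (1 + norm x)"
    and q_growth: "\<And>i t x. 0 < t \<Longrightarrow> t \<le> T \<Longrightarrow> norm (q i t x) \<le> D * (1 + norm x)"
    and sub: "\<And>i t x. 0 < t \<Longrightarrow> t \<le> T \<Longrightarrow> 0 < v t x $ i \<Longrightarrow> (\<forall>j. v t x $ j \<le> v t x $ i) \<Longrightarrow>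
      vt i t x - (\<Sum>\<alpha>\<in>UNIV. DF i t x (axis \<alpha> 1) $ \<alpha>) + q i t x \<bullet> Dv i t x \<le> \<beta> * v t x $ i"
    and "0 \<le> t" "t \<le> T"
  shows "v t x $ i \<le> 0"
proof (rule ccontr)
  assume "\<not> v t x $ i \<le> 0"
  define M where "M = 4 * D * (2 * real CARD('n) + 1) + 1"
  have "1 \<le> M" using \<open>0 \<le> D\<close> by (simp add: M_def)
  define \<epsilon> where "\<epsilon> = exp (- \<beta> * t) * v t x $ i / (2 * (exp (M * t) * (1 + x \<bullet> x)))"
  have "0 < \<epsilon>" using \<open>\<not> v t x $ i \<le> 0\<close> by (simp add: \<epsilon>_def add_pos_nonneg)
  define z where "z j s y = exp (- \<beta> * s) * v s y $ j - \<epsilon> * exp (M * s) * (1 + y \<bullet> y)" for j s y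
  have "0 < z i t x"
  proof -
    have "0 < exp (M * t) * (1 + x \<bullet> x)" by (simp add: add_pos_nonneg)
    moreover have "c / (2 * Q) * Q = c / 2" if "0 < Q" for c Q :: real using that by simp
    ultimately have "\<epsilon> * exp (M * t) * (1 + x \<bullet> x) = exp (- \<beta> * t) * v t x $ i / 2"
      unfolding \<epsilon>_def mult.assoc[of _ "exp (M * t)"] by blast
    moreover have "0 < exp (- \<beta> * t) * v t x $ i" using \<open>\<not> v t x $ i \<le> 0\<close> by simp
    ultimately show ?thesis by (simp add: z_def)
  qed
  obtain i0 t0 x0 where t0: "0 \<le> t0" "t0 \<le> T" and "0 < z i0 t0 x0"
    and z_max: "\<And>j s y. 0 \<le> s \<Longrightarrow> s \<le> T \<Longrightarrow> z j s y \<le> z i0 t0 x0"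
  proof (rule max_over_components_attained[of T z "exp (\<bar>\<beta>\<bar> * T) * max B 0 / \<epsilon> + 1" t i x])
    show "continuous_on ({0..T} \<times> UNIV) (\<lambda>p. z j (fst p) (snd p))" for j
      unfolding z_def by (intro continuous_intros continuous_on_mult cont)
    show "z j s y < 0" if "0 \<le> s" "s \<le> T" "exp (\<bar>\<beta>\<bar> * T) * max B 0 / \<epsilon> + 1 < norm y" for j s y
      using penalty_dominates_far[OF \<open>0 < \<epsilon>\<close> _ that(1,2) bdd[OF that(1,2)] that(3)] \<open>1 \<le> M\<close>
      by (simp add: z_def)
  qed (use \<open>0 \<le> t\<close> \<open>t \<le> T\<close> \<open>0 < z i t x\<close> in auto)
  have "0 < t0"
  proof (rule ccontr)
    assume "\<not> 0 < t0"
    moreover have "0 < \<epsilon> * (1 + x0 \<bullet> x0)" using \<open>0 < \<epsilon>\<close> by (simp add: add_pos_nonneg)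
    ultimately have "z i0 t0 x0 < 0" using t0 init[where i = i0 and x = x0] by (simp add: z_def)
    with \<open>0 < z i0 t0 x0\<close> show False by simp
  qed
  have "0 < v t0 x0 $ i0"
    using \<open>0 < z i0 t0 x0\<close> \<open>0 < \<epsilon>\<close> unfolding z_def
    by (smt (verit) exp_gt_zero inner_ge_zero mult_pos_pos zero_less_mult_iff)
  moreover have "v t0 x0 $ j \<le> v t0 x0 $ i0" for j
    using z_max[OF t0, of j x0] by (simp add: z_def)
  ultimately have sub_i0: "vt i0 t0 x0 - (\<Sum>\<alpha>\<in>UNIV. DF i0 t0 x0 (axis \<alpha> 1) $ \<alpha>) + q i0 t0 x0 \<bullet> Dv i0 t0 x0
      \<le> \<beta> * v t0 x0 $ i0"
    using sub[OF \<open>0 < t0\<close> t0(2)] by blast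
  have "M \<le> 4 * D * (2 * real CARD('n) + 1)"
  proof (rule penalised_subsolution_no_interior_max[OF \<open>0 < \<epsilon>\<close> \<open>0 < t0\<close>, where w = "\<lambda>s y. v s y $ i0"
        and A = "A i0 t0" and dA = "dA i0 t0 x0" and DF = "DF i0 t0 x0" and Dw = "Dv i0 t0"
        and H = "D2v i0 t0 x0" and wt = "vt i0 t0 x0" and b = "q i0 t0 x0", OF _ _ _ _ _ _ _ _ _ _ _ _ sub_i0])
    show "exp (- \<beta> * s) * v s x0 $ i0 - \<epsilon> * exp (M * s) * (1 + x0 \<bullet> x0)
      \<le> exp (- \<beta> * t0) * v t0 x0 $ i0 - \<epsilon> * exp (M * t0) * (1 + x0 \<bullet> x0)" if "0 < s" "s < t0" for s
      using z_max[where j = i0 and s = s and y = x0] that t0 by (simp add: z_def)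
    show "exp (- \<beta> * t0) * v t0 y $ i0 - \<epsilon> * exp (M * t0) * (1 + y \<bullet> y)
      \<le> exp (- \<beta> * t0) * v t0 x0 $ i0 - \<epsilon> * exp (M * t0) * (1 + x0 \<bullet> x0)" for y
      using z_max[OF t0, of i0 y] by (simp add: z_def)
  qed (use dt dx dxx dF dA sym psd A_growth dA_growth q_growth \<open>0 < t0\<close> t0 in auto)
  then show False by (simp add: M_def)
qed

section \<open>Periodic Hoelder continuous coefficients\<close>

lemma periodic_shift_of_int:
  fixes g :: "real \<Rightarrow> 'b"
  assumes "\<And>s. g (s + p) = g s"
  shows "g (s + of_int k * p) = g s"
proof -
  interpret periodic_fun_simple g p by standard (rule assms)
  show ?thesis by (rule plus_of_int)
qed

lemma periodic_tx_fundamental_domain: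
  assumes per: "periodic_tx T L f" and "0 < T" and L: "\<And>\<alpha>. 0 < L $ \<alpha>"
  obtains s y where "0 \<le> s" "s \<le> T" "\<And>\<alpha>. \<bar>y $ \<alpha>\<bar> \<le> L $ \<alpha>" "f s y = f t x"
proof
  have per_t: "f (s + T) x = f s x" and per_x: "f s (y + L $ \<alpha> *\<^sub>R axis \<alpha> 1) = f s y" for s x y \<alpha>
    using per unfolding periodic_tx_def by auto
  define k where "k \<alpha> = \<lfloor>x $ \<alpha> / L $ \<alpha>\<rfloor>" for \<alpha>
  define s where "s = t + of_int (- \<lfloor>t / T\<rfloor>) * T"
  define y where "y = x - (\<Sum>\<alpha>\<in>UNIV. (of_int (k \<alpha>) * L $ \<alpha>) *\<^sub>R axis \<alpha> 1)"
  from floor_divide_lower[OF \<open>0 < T\<close>, of t] floor_divide_upper[OF \<open>0 < T\<close>, of t]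
  show "0 \<le> s" "s \<le> T" by (simp_all add: s_def algebra_simps)
  show "\<bar>y $ \<alpha>\<bar> \<le> L $ \<alpha>" for \<alpha>
  proof -
    have "(\<Sum>\<beta>\<in>UNIV. (of_int (k \<beta>) * L $ \<beta>) *\<^sub>R axis \<beta> (1::real)) $ \<alpha> = of_int (k \<alpha>) * L $ \<alpha>"
      by (simp add: sum_component axis_def if_distrib cong: if_cong)
    moreover have "of_int (k \<alpha>) * L $ \<alpha> \<le> x $ \<alpha>" "x $ \<alpha> < (of_int (k \<alpha>) + 1) * L $ \<alpha>"
      unfolding k_def using floor_divide_lower floor_divide_upper L by blast+
    ultimately show ?thesis by (simp add: y_def algebra_simps)
  qed
  have shift_x: "f s (z + (of_int j * L $ \<alpha>) *\<^sub>R axis \<alpha> 1) = f s z" for z j \<alpha>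
  proof -
    have "f s (z + (r + L $ \<alpha>) *\<^sub>R axis \<alpha> 1) = f s (z + r *\<^sub>R axis \<alpha> 1)" for r
      using per_x[of s "z + r *\<^sub>R axis \<alpha> 1" \<alpha>] by (simp add: scaleR_add_left add.assoc)
    from periodic_shift_of_int[of "\<lambda>r. f s (z + r *\<^sub>R axis \<alpha> 1)", OF this, of 0 j] show ?thesis
      by simp
  qed
  have "finite F \<Longrightarrow> f s (x - (\<Sum>\<alpha>\<in>F. (of_int (k \<alpha>) * L $ \<alpha>) *\<^sub>R axis \<alpha> 1)) = f s x" for F
  proof (induction F rule: finite_induct)
    case (insert \<beta> F)
    then show ?case
      using shift_x[of "x - (\<Sum>\<alpha>\<in>F. (of_int (k \<alpha>) * L $ \<alpha>) *\<^sub>R axis \<alpha> 1)" "- k \<beta>" \<beta>]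
      by (simp add: algebra_simps)
  qed simp
  then have "f s y = f s x" by (simp add: y_def)
  also have "\<dots> = f t x"
    using periodic_shift_of_int[of "\<lambda>r. f r x" T t "- \<lfloor>t / T\<rfloor>"] per_t by (simp add: s_def)
  finally show "f s y = f t x" .
qed

lemma holder_tx_bound:
  assumes "holder_tx \<delta> f"
  shows "\<exists>C\<ge>0. \<forall>t x. norm (f t x) \<le> norm (f 0 0) + C * (\<bar>t\<bar> powr (\<delta> / 2) + norm x powr \<delta>)"
proof -
  obtain C where C: "\<And>t s x y. norm (f t x - f s y) \<le> C * (\<bar>t - s\<bar> powr (\<delta> / 2) + norm (x - y) powr \<delta>)"
    using assms unfolding holder_tx_def by blast
  have "norm (f t x) \<le> norm (f 0 0) + \<bar>C\<bar> * (\<bar>t\<bar> powr (\<delta> / 2) + norm x powr \<delta>)" for t x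
  proof -
    have "norm (f t x) \<le> norm (f 0 0) + norm (f t x - f 0 0)" by (metis norm_triangle_sub add.commute)
    also have "norm (f t x - f 0 0) \<le> C * (\<bar>t\<bar> powr (\<delta> / 2) + norm x powr \<delta>)" using C[of t x 0 0] by simp
    also have "\<dots> \<le> \<bar>C\<bar> * (\<bar>t\<bar> powr (\<delta> / 2) + norm x powr \<delta>)" by (intro mult_right_mono) auto
    finally show ?thesis by simp
  qed
  then show ?thesis by (intro exI[of _ "\<bar>C\<bar>"]) simp
qed

lemma powr_le_1_plus:
  fixes x :: real
  assumes "0 \<le> x" "0 \<le> a" "a \<le> 1"
  shows "x powr a \<le> 1 + x"
proof (cases "x \<le> 1")
  case True
  with assms have "x powr a \<le> 1" by (cases "x = 0") (auto intro: powr_le1)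
  with assms show ?thesis by simp
next
  case False
  with assms have "x powr a \<le> x powr 1" by (intro powr_mono) auto
  with False show ?thesis by simp
qed

lemma holder_tx_linear_growth:
  fixes f :: "'j::finite \<Rightarrow> real \<Rightarrow> real^'n \<Rightarrow> 'b::real_normed_vector"
  assumes holder: "\<And>j. holder_tx \<delta> (f j)" and "0 \<le> \<delta>" "\<delta> \<le> 1" and "0 \<le> T"
  obtains D where "0 \<le> D" "\<And>j t x. 0 \<le> t \<Longrightarrow> t \<le> T \<Longrightarrow> norm (f j t x) \<le> D * (1 + norm x)"
proof -
  from holder_tx_bound[OF holder] have "\<forall>j. \<exists>C\<ge>0. \<forall>t x.
      norm (f j t x) \<le> norm (f j 0 0) + C * (\<bar>t\<bar> powr (\<delta> / 2) + norm x powr \<delta>)" ..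
  then obtain C where C: "\<And>j. 0 \<le> C j"
    "\<And>j t x. norm (f j t x) \<le> norm (f j 0 0) + C j * (\<bar>t\<bar> powr (\<delta> / 2) + norm x powr \<delta>)"
    by (metis choice)
  define D where "D j = norm (f j 0 0) + C j * (2 + T)" for j
  have growth_j: "norm (f j t x) \<le> D j * (1 + norm x)" if "0 \<le> t" "t \<le> T" for j t x
  proof -
    have "\<bar>t\<bar> powr (\<delta> / 2) \<le> 1 + \<bar>t\<bar>" by (rule powr_le_1_plus) (use assms(2,3) in auto)
    moreover have "norm x powr \<delta> \<le> 1 + norm x" by (rule powr_le_1_plus) (use assms(2,3) in auto)
    ultimately have "\<bar>t\<bar> powr (\<delta> / 2) + norm x powr \<delta> \<le> (1 + T) + (1 + norm x)" using that by linarith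
    then have "C j * (\<bar>t\<bar> powr (\<delta> / 2) + norm x powr \<delta>) \<le> C j * ((1 + T) + (1 + norm x))"
      using C(1)[of j] by (rule mult_left_mono)
    then have "norm (f j t x) \<le> norm (f j 0 0) + C j * ((1 + T) + (1 + norm x))"
      using C(2)[of j t x] by linarith
    also have "\<dots> \<le> norm (f j 0 0) + C j * (2 + T) + C j * (2 + T) * norm x"
    proof -
      have "C j * 1 \<le> C j * (2 + T)" using C(1)[of j] \<open>0 \<le> T\<close> by (intro mult_left_mono) auto
      then have "C j * norm x \<le> C j * (2 + T) * norm x" by (intro mult_right_mono) auto
      then show ?thesis by (simp add: algebra_simps)
    qed
    also have "\<dots> \<le> D j * (1 + norm x)"
      unfolding D_def by (simp add: algebra_simps)
    finally show ?thesis .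
  qed
  show thesis
  proof (rule that[of "\<Sum>j\<in>UNIV. D j"])
    have D_nonneg: "0 \<le> D j" for j using C(1)[of j] \<open>0 \<le> T\<close> by (simp add: D_def)
    then show "0 \<le> (\<Sum>j\<in>UNIV. D j)" by (simp add: sum_nonneg)
    fix j t and x :: "real^'n" assume "0 \<le> t" "t \<le> T"
    have "D j \<le> (\<Sum>j\<in>UNIV. D j)" by (rule member_le_sum) (use D_nonneg in auto)
    then have "D j * (1 + norm x) \<le> (\<Sum>j\<in>UNIV. D j) * (1 + norm x)" by (intro mult_right_mono) auto
    with growth_j[OF \<open>0 \<le> t\<close> \<open>t \<le> T\<close>] show "norm (f j t x) \<le> (\<Sum>j\<in>UNIV. D j) * (1 + norm x)"
      by (rule order_trans)
  qed
qed

lemma periodic_tx_bounded: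
  assumes per: "periodic_tx T L f" and holder: "holder_tx \<delta> f" and "0 \<le> \<delta>"
    and "0 < T" and L: "\<And>\<alpha>. 0 < L $ \<alpha>"
  obtains C where "\<And>t x. norm (f t x) \<le> C"
proof -
  obtain C where "0 \<le> C"
    and C: "\<And>t x. norm (f t x) \<le> norm (f 0 0) + C * (\<bar>t\<bar> powr (\<delta> / 2) + norm x powr \<delta>)"
    using holder_tx_bound[OF holder] by blast
  show thesis
  proof (rule that)
    fix t x
    obtain s y where s: "0 \<le> s" "s \<le> T" and y: "\<And>\<alpha>. \<bar>y $ \<alpha>\<bar> \<le> L $ \<alpha>" and "f s y = f t x"
      using periodic_tx_fundamental_domain[OF per \<open>0 < T\<close> L] by blast
    have "norm y \<le> (\<Sum>\<alpha>\<in>UNIV. L $ \<alpha>)"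
      using norm_le_l1_cart[of y] sum_mono[of UNIV "\<lambda>\<alpha>. \<bar>y $ \<alpha>\<bar>", OF y] by linarith
    then have "\<bar>s\<bar> powr (\<delta> / 2) + norm y powr \<delta> \<le> T powr (\<delta> / 2) + (\<Sum>\<alpha>\<in>UNIV. L $ \<alpha>) powr \<delta>"
      using s \<open>0 \<le> \<delta>\<close> by (intro add_mono powr_mono2) auto
    then have "C * (\<bar>s\<bar> powr (\<delta> / 2) + norm y powr \<delta>) \<le> C * (T powr (\<delta> / 2) + (\<Sum>\<alpha>\<in>UNIV. L $ \<alpha>) powr \<delta>)"
      using \<open>0 \<le> C\<close> by (rule mult_left_mono)
    with C[of s y] \<open>f s y = f t x\<close>
    show "norm (f t x) \<le> norm (f 0 0) + C * (T powr (\<delta> / 2) + (\<Sum>\<alpha>\<in>UNIV. L $ \<alpha>) powr \<delta>)"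
      by simp
  qed
qed

section \<open>The reaction term\<close>

definition kpp_reaction :: "real^'k^'k \<Rightarrow> real^'k^'k \<Rightarrow> real^'k \<Rightarrow> 'k::finite \<Rightarrow> real" where
  "kpp_reaction l c w i = (\<Sum>j\<in>UNIV. l$i$j * w$j) - w$i * (\<Sum>j\<in>UNIV. c$i$j * w$j)"

lemma kpp_reaction_lower_bound:
  fixes l c :: "real^'k^'k::finite" and w :: "real^'k"
  assumes l_offdiag: "\<And>j. j \<noteq> i \<Longrightarrow> 0 \<le> l$i$j" and l_le: "\<And>j. l$i$j \<le> Lb"
    and c_nonneg: "\<And>j. 0 \<le> c$i$j" and c_le: "\<And>j. c$i$j \<le> Cb"
    and w_min: "\<And>j. w$i \<le> w$j" and "w$i < 0" and "- w$i \<le> B"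
  shows "(real CARD('k) * Lb + real CARD('k) * Cb * B) * w$i \<le> kpp_reaction l c w i"
proof -
  let ?N = "real CARD('k)"
  have "?N * Lb * w$i \<le> (\<Sum>j\<in>UNIV. l$i$j) * w$i"
    using sum_bounded_above[of UNIV "\<lambda>j. l$i$j" Lb] l_le \<open>w$i < 0\<close> by (intro mult_right_mono_neg) auto
  also have "\<dots> \<le> (\<Sum>j\<in>UNIV. l$i$j * w$j)"
    unfolding sum_distrib_right
    by (rule sum_mono) (metis l_offdiag w_min mult_left_mono order_refl)
  finally have l_part: "?N * Lb * w$i \<le> (\<Sum>j\<in>UNIV. l$i$j * w$j)" .
  have "?N * Cb * w$i \<le> (\<Sum>j\<in>UNIV. c$i$j) * w$i"
    using sum_bounded_above[of UNIV "\<lambda>j. c$i$j" Cb] c_le \<open>w$i < 0\<close> by (intro mult_right_mono_neg) auto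
  also have "\<dots> \<le> (\<Sum>j\<in>UNIV. c$i$j * w$j)"
    unfolding sum_distrib_right by (rule sum_mono) (use c_nonneg w_min in \<open>auto intro: mult_left_mono\<close>)
  finally have "(- w$i) * (?N * Cb * w$i) \<le> (- w$i) * (\<Sum>j\<in>UNIV. c$i$j * w$j)"
    using \<open>w$i < 0\<close> by (intro mult_left_mono) auto
  moreover have "(?N * Cb * w$i) * B \<le> (?N * Cb * w$i) * (- w$i)"
  proof (rule mult_left_mono_neg)
    have "0 \<le> Cb" using c_nonneg c_le order_trans by blast
    with \<open>w$i < 0\<close> show "?N * Cb * w$i \<le> 0" by (simp add: mult_nonneg_nonpos)
  qed (rule \<open>- w$i \<le> B\<close>)
  ultimately show ?thesis using l_part unfolding kpp_reaction_def by (simp add: algebra_simps)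
qed

lemma kpp_reaction_upper_bound:
  fixes l c :: "real^'k^'k::finite" and w :: "real^'k"
  assumes l_offdiag: "\<And>j. j \<noteq> i \<Longrightarrow> 0 \<le> l$i$j" and l_le: "\<And>j. l$i$j \<le> Lb"
    and c_nonneg: "\<And>j. 0 \<le> c$i$j" and c_diag: "c0 \<le> c$i$i"
    and w_nonneg: "\<And>j. 0 \<le> w$j" and w_max: "\<And>j. w$j \<le> w$i"
  shows "kpp_reaction l c w i \<le> real CARD('k) * Lb * w$i - c0 * (w$i)\<^sup>2"
proof -
  have "(\<Sum>j\<in>UNIV. l$i$j * w$j) \<le> (\<Sum>j\<in>UNIV. l$i$j) * w$i"
    unfolding sum_distrib_right by (rule sum_mono) (metis l_offdiag w_max mult_left_mono order_refl)
  also have "\<dots> \<le> real CARD('k) * Lb * w$i"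
    using sum_bounded_above[of UNIV "\<lambda>j. l$i$j" Lb] l_le w_nonneg[of i] by (intro mult_right_mono) auto
  finally have l_part: "(\<Sum>j\<in>UNIV. l$i$j * w$j) \<le> real CARD('k) * Lb * w$i" .
  have "c0 * w$i \<le> c$i$i * w$i" using c_diag w_nonneg[of i] by (rule mult_right_mono)
  also have "\<dots> \<le> (\<Sum>j\<in>UNIV. c$i$j * w$j)"
    by (rule member_le_sum[where f = "\<lambda>j. c$i$j * w$j"]) (use c_nonneg w_nonneg in auto)
  finally have "w$i * (c0 * w$i) \<le> w$i * (\<Sum>j\<in>UNIV. c$i$j * w$j)"
    using w_nonneg[of i] by (rule mult_left_mono)
  with l_part show ?thesis unfolding kpp_reaction_def by (simp add: power2_eq_square algebra_simps)
qed

text \<open>Why \<open>\<kappa> + y\<close> with \<open>y' = - c\<^sub>0 y\<^sup>2\<close> is a supersolution of \<open>U' = c\<^sub>0 U (\<kappa> - U)\<close>: above it, the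
  excess of the reaction over \<open>y'\<close> is bounded linearly by \<open>U - (\<kappa> + y)\<close>.\<close>
lemma logistic_supersolution_ineq:
  fixes c0 \<kappa> y U :: real
  assumes "0 < c0" "0 \<le> \<kappa>" "0 \<le> y" "\<kappa> + y \<le> U"
  shows "c0 * \<kappa> * U - c0 * U\<^sup>2 + c0 * y\<^sup>2 \<le> c0 * \<kappa> * (U - (\<kappa> + y))"
proof -
  have "(\<kappa> + y)\<^sup>2 \<le> U\<^sup>2" using assms by (intro power_mono) auto
  moreover have "0 \<le> y * \<kappa>" using assms by simp
  ultimately have "\<kappa> * (\<kappa> + y) + y\<^sup>2 \<le> U\<^sup>2" by (simp add: power2_eq_square algebra_simps)
  then have "c0 * (\<kappa> * (\<kappa> + y) + y\<^sup>2) \<le> c0 * U\<^sup>2" using \<open>0 < c0\<close> by (intro mult_left_mono) auto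
  then show ?thesis by (simp add: algebra_simps)
qed

section \<open>Consequences of the standing assumptions\<close>

context
  fixes T :: real and L :: "real^'n"
    and A :: "'k::finite \<Rightarrow> real \<Rightarrow> real^'n \<Rightarrow> real^'n^'n"
    and q :: "'k \<Rightarrow> real \<Rightarrow> real^'n \<Rightarrow> real^'n"
    and Lc Cc :: "real \<Rightarrow> real^'n \<Rightarrow> real^'k^'k"
  assumes standing: "standing_assumptions T L A q Lc Cc"
begin

lemma standing_symmetric: "transpose (A i t x) = A i t x"
  using standing unfolding standing_assumptions_def by (elim conjE) (simp only:)

lemma standing_Cc_inf_pos: "0 < (INF tx. Cc (fst tx) (snd tx) $ i $ j)"
  using standing unfolding standing_assumptions_def by (elim conjE) (simp only:)

lemma standing_periodic: "periodic_tx T L Lc" "periodic_tx T L Cc" "0 < T" "0 < L $ \<alpha>"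
  using standing unfolding standing_assumptions_def by (elim conjE; simp only:)+

lemma standing_offdiag: "i \<noteq> j \<Longrightarrow> 0 \<le> Lc t x $ i $ j"
  using standing unfolding standing_assumptions_def by (elim conjE) (simp only: not_False_eq_True)

lemma standing_ellipticity: "\<exists>\<mu>>0. \<forall>i t x y. norm y = 1 \<longrightarrow> \<mu> \<le> y \<bullet> (A i t x *v y)"
  using standing unfolding standing_assumptions_def by (elim conjE)

lemma standing_holder:
  "\<exists>\<delta>>0. \<delta> < 1 \<and> holder_tx \<delta> Lc \<and> holder_tx \<delta> Cc \<and> (\<forall>i. holder_tx \<delta> (q i) \<and> holder_tx_C1 \<delta> (A i))"
  using standing unfolding standing_assumptions_def by (elim conjE)

lemma standing_psd: "0 \<le> h \<bullet> (A i t x *v h)"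
proof (cases "h = 0")
  case False
  obtain \<mu> where "0 < \<mu>" and ellipticity: "\<And>y. norm y = 1 \<Longrightarrow> \<mu> \<le> y \<bullet> (A i t x *v y)"
    using standing_ellipticity by blast
  define y where "y = (1 / norm h) *\<^sub>R h"
  have "norm y = 1" and h: "h = norm h *\<^sub>R y" using False by (simp_all add: y_def)
  have "h \<bullet> (A i t x *v h) = (norm h)\<^sup>2 * (y \<bullet> (A i t x *v y))"
    by (subst (1 2) h) (simp add: matrix_vector_mult_scaleR power2_eq_square)
  with ellipticity[OF \<open>norm y = 1\<close>] \<open>0 < \<mu>\<close> show ?thesis by simp
qed simp

lemma standing_reaction_bounds:
  obtains Lb Cb c0 where "0 \<le> Lb" "0 < c0" "\<And>t x i j. Lc t x $ i $ j \<le> Lb"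
    "\<And>t x i j. 0 \<le> Cc t x $ i $ j" "\<And>t x i j. Cc t x $ i $ j \<le> Cb" "\<And>t x i. c0 \<le> Cc t x $ i $ i"
proof -
  obtain \<delta> where "0 \<le> \<delta>" and holder: "holder_tx \<delta> Lc" "holder_tx \<delta> Cc"
    using standing_holder less_imp_le by blast
  obtain Lb where Lb: "\<And>t x. norm (Lc t x) \<le> Lb"
    using periodic_tx_bounded[OF standing_periodic(1) holder(1) \<open>0 \<le> \<delta>\<close> standing_periodic(3,4)] by blast
  obtain Cb where Cb: "\<And>t x. norm (Cc t x) \<le> Cb"
    using periodic_tx_bounded[OF standing_periodic(2) holder(2) \<open>0 \<le> \<delta>\<close> standing_periodic(3,4)] by blast
  have Lc_le: "Lc t x $ i $ j \<le> Lb" and Cc_le: "\<bar>Cc t x $ i $ j\<bar> \<le> Cb" for t x i j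
    using abs_matrix_entry_le_norm[of "Lc t x" i j] Lb[of t x]
      abs_matrix_entry_le_norm[of "Cc t x" i j] Cb[of t x] by linarith+
  define inf_C where "inf_C i j = (INF tx. Cc (fst tx) (snd tx) $ i $ j)" for i j
  have inf_C_le: "inf_C i j \<le> Cc t x $ i $ j" for t x i j
  proof -
    have "- Cb \<le> Cc (fst tx) (snd tx) $ i $ j" for tx
      using Cc_le[of "fst tx" "snd tx" i j] by (simp add: abs_le_iff)
    then have "bdd_below (range (\<lambda>tx. Cc (fst tx) (snd tx) $ i $ j))" by (intro bdd_belowI) auto
    from cINF_lower[OF this, of "(t, x)"] show ?thesis by (simp add: inf_C_def)
  qed
  have inf_C_pos: "0 < inf_C i j" for i j unfolding inf_C_def by (rule standing_Cc_inf_pos)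
  define c0 where "c0 = Min (range (\<lambda>i. inf_C i i))"
  show thesis
  proof (rule that[of Lb c0 Cb])
    show "0 \<le> Lb" using Lb[of 0 0] norm_ge_zero[of "Lc 0 0"] by linarith
    show "0 < c0" unfolding c0_def using inf_C_pos by (subst Min_gr_iff) auto
    show "c0 \<le> Cc t x $ i $ i" for t x i
    proof -
      have "c0 \<le> inf_C i i" unfolding c0_def by (rule Min_le) auto
      with inf_C_le[of i i t x] show ?thesis by simp
    qed
    show "0 \<le> Cc t x $ i $ j" for t x i j using inf_C_pos[of i j] inf_C_le[of i j t x] by simp
  qed (use Lc_le Cc_le in \<open>auto simp: abs_le_iff\<close>)
qed

lemma standing_coefficient_growth:
  assumes "0 \<le> T'"
  obtains dA D where "0 \<le> D" "\<And>i t x. (A i t has_derivative (\<lambda>h. \<Sum>\<alpha>\<in>UNIV. h$\<alpha> *\<^sub>R dA i t x \<alpha>)) (at x)"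
    "\<And>i t x. 0 \<le> t \<Longrightarrow> t \<le> T' \<Longrightarrow> norm (A i t x) \<le> D * (1 + norm x)"
    "\<And>i t x \<alpha>. 0 \<le> t \<Longrightarrow> t \<le> T' \<Longrightarrow> norm (dA i t x \<alpha>) \<le> D * (1 + norm x)"
    "\<And>i t x. 0 \<le> t \<Longrightarrow> t \<le> T' \<Longrightarrow> norm (q i t x) \<le> D * (1 + norm x)"
proof -
  obtain \<delta> where \<delta>: "0 < \<delta>" "\<delta> < 1" and holder: "\<And>i. holder_tx \<delta> (q i)" "\<And>i. holder_tx_C1 \<delta> (A i)"
    using standing_holder by blast
  have "\<forall>i. \<exists>dA :: real \<Rightarrow> real^'n \<Rightarrow> 'n \<Rightarrow> real^'n^'n.
      (\<forall>t x. (A i t has_derivative (\<lambda>h. \<Sum>\<alpha>\<in>UNIV. h$\<alpha> *\<^sub>R dA t x \<alpha>)) (at x)) \<and>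
      (\<forall>\<alpha>. holder_tx \<delta> (\<lambda>t x. dA t x \<alpha>))"
    using holder(2) unfolding holder_tx_C1_def by blast
  then obtain dA where "\<forall>i. (\<forall>t x. (A i t has_derivative (\<lambda>h. \<Sum>\<alpha>\<in>UNIV. h$\<alpha> *\<^sub>R dA i t x \<alpha>)) (at x)) \<and>
      (\<forall>\<alpha>. holder_tx \<delta> (\<lambda>t x. dA i t x \<alpha>))"
    by (auto dest: choice)
  then have dA: "\<And>i t x. (A i t has_derivative (\<lambda>h. \<Sum>\<alpha>\<in>UNIV. h$\<alpha> *\<^sub>R dA i t x \<alpha>)) (at x)"
    and holder_dA: "\<And>i \<alpha>. holder_tx \<delta> (\<lambda>t x. dA i t x \<alpha>)"
    by blast+
  have "0 \<le> \<delta>" "\<delta> \<le> 1" using \<delta> by simp_all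
  have "\<And>i. holder_tx \<delta> (A i)" using holder(2) unfolding holder_tx_C1_def by blast
  obtain D1 where "0 \<le> D1" and D1: "\<And>i t x. 0 \<le> t \<Longrightarrow> t \<le> T' \<Longrightarrow> norm (A i t x) \<le> D1 * (1 + norm x)"
    using holder_tx_linear_growth[where f = A, OF \<open>\<And>i. holder_tx \<delta> (A i)\<close> \<open>0 \<le> \<delta>\<close> \<open>\<delta> \<le> 1\<close> assms]
    by blast
  obtain D2 where "0 \<le> D2"
    and D2: "\<And>p t x. 0 \<le> t \<Longrightarrow> t \<le> T' \<Longrightarrow> norm (dA (fst p) t x (snd p)) \<le> D2 * (1 + norm x)"
    using holder_tx_linear_growth[where f = "\<lambda>p t x. dA (fst p) t x (snd p)",
          OF holder_dA \<open>0 \<le> \<delta>\<close> \<open>\<delta> \<le> 1\<close> assms] by blast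
  obtain D3 where "0 \<le> D3" and D3: "\<And>i t x. 0 \<le> t \<Longrightarrow> t \<le> T' \<Longrightarrow> norm (q i t x) \<le> D3 * (1 + norm x)"
    using holder_tx_linear_growth[where f = q, OF holder(1) \<open>0 \<le> \<delta>\<close> \<open>\<delta> \<le> 1\<close> assms] by blast
  have weaken: "a \<le> D' * (1 + norm x)" if "a \<le> D * (1 + norm x)" "D \<le> D'" for a D D' and x :: "real^'n"
    using that mult_right_mono[OF \<open>D \<le> D'\<close>, of "1 + norm x"] by simp
  show thesis
  proof (rule that[of "D1 + D2 + D3" dA])
    show "0 \<le> D1 + D2 + D3" using \<open>0 \<le> D1\<close> \<open>0 \<le> D2\<close> \<open>0 \<le> D3\<close> by simp
    show "norm (A i t x) \<le> (D1 + D2 + D3) * (1 + norm x)" if "0 \<le> t" "t \<le> T'" for i t x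
      by (rule weaken[of _ D1]) (use D1 that \<open>0 \<le> D2\<close> \<open>0 \<le> D3\<close> in auto)
    show "norm (dA i t x \<alpha>) \<le> (D1 + D2 + D3) * (1 + norm x)" if "0 \<le> t" "t \<le> T'" for i t x \<alpha>
      by (rule weaken[of _ D2]) (use D2[of t "(i, \<alpha>)"] that \<open>0 \<le> D1\<close> \<open>0 \<le> D3\<close> in auto)
    show "norm (q i t x) \<le> (D1 + D2 + D3) * (1 + norm x)" if "0 \<le> t" "t \<le> T'" for i t x
      by (rule weaken[of _ D3]) (use D3 that \<open>0 \<le> D1\<close> \<open>0 \<le> D2\<close> in auto)
  qed (rule dA)
qed

end

section \<open>Solutions of the Cauchy problem\<close>

lemma kpp_solution_derivatives:
  fixes A :: "'k::finite \<Rightarrow> real \<Rightarrow> real^'n \<Rightarrow> real^'n^'n"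
  assumes "kpp_solution A q Lc Cc u0 u"
  obtains ut Du D2u DF where
    "\<And>i t x. 0 < t \<Longrightarrow> ((\<lambda>s. u s x $ i) has_real_derivative ut i t x) (at t)"
    "\<And>i t x. 0 < t \<Longrightarrow> ((\<lambda>y. u t y $ i) has_derivative (\<lambda>h. Du i t x \<bullet> h)) (at x)"
    "\<And>i t x. 0 < t \<Longrightarrow> (Du i t has_derivative (\<lambda>h. D2u i t x *v h)) (at x)"
    "\<And>i t x. 0 < t \<Longrightarrow> ((\<lambda>y. A i t y *v Du i t y) has_derivative DF i t x) (at x)"
    "\<And>i t x. 0 < t \<Longrightarrow> ut i t x - (\<Sum>\<alpha>\<in>UNIV. DF i t x (axis \<alpha> 1) $ \<alpha>) + q i t x \<bullet> Du i t x
      = kpp_reaction (Lc t x) (Cc t x) (u t x) i"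
proof -
  define P where "P i ut Du D2u DF \<longleftrightarrow>
    (\<forall>t>0. \<forall>x. ((\<lambda>s. u s x $ i) has_real_derivative ut t x) (at t)) \<and>
    (\<forall>t>0. \<forall>x. ((\<lambda>y. u t y $ i) has_derivative (\<lambda>h. Du t x \<bullet> h)) (at x)) \<and>
    (\<forall>t>0. \<forall>x. (Du t has_derivative (\<lambda>h. D2u t x *v h)) (at x)) \<and>
    (\<forall>t>0. \<forall>x. ((\<lambda>y. A i t y *v Du t y) has_derivative DF t x) (at x)) \<and>
    (\<forall>t>0. \<forall>x. ut t x - (\<Sum>\<alpha>\<in>UNIV. DF t x (axis \<alpha> 1) $ \<alpha>) + q i t x \<bullet> Du t x
       = kpp_reaction (Lc t x) (Cc t x) (u t x) i)"
    for i and ut :: "real \<Rightarrow> real^'n \<Rightarrow> real" and Du :: "real \<Rightarrow> real^'n \<Rightarrow> real^'n"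
      and D2u :: "real \<Rightarrow> real^'n \<Rightarrow> real^'n^'n" and DF :: "real \<Rightarrow> real^'n \<Rightarrow> real^'n \<Rightarrow> real^'n"
  have "\<forall>i. \<exists>ut Du D2u DF. P i ut Du D2u DF"
    using assms unfolding kpp_solution_def P_def kpp_reaction_def
    by (elim conjE) (erule all_forward, elim exE conjE, intro exI conjI; assumption)
  then obtain ut Du D2u DF where "\<And>i. P i (ut i) (Du i) (D2u i) (DF i)" by metis
  then show thesis by (intro that[of ut Du D2u DF]) (simp_all add: P_def)
qed

lemma kpp_solution_continuous:
  assumes "kpp_solution A q Lc Cc u0 u"
  shows "continuous_on ({0..T'} \<times> UNIV) (\<lambda>p. u (fst p) (snd p) $ j)"
proof -
  have "continuous_on ({0..} \<times> UNIV) (\<lambda>p. u (fst p) (snd p))"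
    using assms unfolding kpp_solution_def case_prod_unfold by (elim conjE)
  then show ?thesis by (rule continuous_on_component[OF continuous_on_subset]) auto
qed

lemma kpp_solution_initial: "kpp_solution A q Lc Cc u0 u \<Longrightarrow> u 0 x = u0 x"
  unfolding kpp_solution_def by (elim conjE) (erule spec)

lemma kpp_solution_bounded_strip:
  assumes "kpp_solution A q Lc Cc u0 u"
  obtains B where "\<And>s y j. 0 \<le> s \<Longrightarrow> s \<le> T' \<Longrightarrow> \<bar>u s y $ j\<bar> \<le> B"
proof -
  have "bounded ((\<lambda>(t, x). u t x) ` ({0..max T' 1} \<times> UNIV))"
    using assms unfolding kpp_solution_def by (elim conjE) (erule allE, erule impE; simp)
  then obtain B where B: "\<And>z. z \<in> (\<lambda>(t, x). u t x) ` ({0..max T' 1} \<times> UNIV) \<Longrightarrow> norm z \<le> B"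
    unfolding bounded_iff by blast
  show thesis
  proof (rule that)
    fix s y j assume "0 \<le> s" "s \<le> T'"
    then have "norm (u s y) \<le> B" by (intro B) force
    then show "\<bar>u s y $ j\<bar> \<le> B" using component_le_norm_cart order_trans by blast
  qed
qed

text \<open>With \<open>\<sigma> = -1\<close> and \<open>\<phi> = 0\<close> this gives nonnegativity; with \<open>\<sigma> = 1\<close> it compares \<open>u\<close> with
  spatially homogeneous supersolutions.\<close>
lemma kpp_comparison:
  fixes T :: real and L :: "real^'n"
    and A :: "'k::finite \<Rightarrow> real \<Rightarrow> real^'n \<Rightarrow> real^'n^'n"
    and q :: "'k \<Rightarrow> real \<Rightarrow> real^'n \<Rightarrow> real^'n"
    and Lc Cc :: "real \<Rightarrow> real^'n \<Rightarrow> real^'k^'k"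
    and u0 :: "real^'n \<Rightarrow> real^'k" and u :: "real \<Rightarrow> real^'n \<Rightarrow> real^'k"
  assumes standing: "standing_assumptions T L A q Lc Cc" and sol: "kpp_solution A q Lc Cc u0 u"
    and \<phi>_cont: "continuous_on {0..T'} \<phi>"
    and \<phi>_deriv: "\<And>s. 0 < s \<Longrightarrow> s \<le> T' \<Longrightarrow> (\<phi> has_real_derivative \<phi>' s) (at s)"
    and init: "\<And>x j. \<sigma> * u0 x $ j \<le> \<phi> 0"
    and sub: "\<And>i s x. 0 < s \<Longrightarrow> s \<le> T' \<Longrightarrow> \<phi> s < \<sigma> * u s x $ i \<Longrightarrow>
      (\<forall>j. \<sigma> * u s x $ j \<le> \<sigma> * u s x $ i) \<Longrightarrow>
      \<sigma> * kpp_reaction (Lc s x) (Cc s x) (u s x) i - \<phi>' s \<le> \<beta> * (\<sigma> * u s x $ i - \<phi> s)"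
    and "0 \<le> t" "t \<le> T'"
  shows "\<sigma> * u t x $ i \<le> \<phi> t"
proof -
  obtain ut Du D2u DF where dt: "\<And>i t x. 0 < t \<Longrightarrow> ((\<lambda>s. u s x $ i) has_real_derivative ut i t x) (at t)"
    and dx: "\<And>i t x. 0 < t \<Longrightarrow> ((\<lambda>y. u t y $ i) has_derivative (\<lambda>h. Du i t x \<bullet> h)) (at x)"
    and dxx: "\<And>i t x. 0 < t \<Longrightarrow> (Du i t has_derivative (\<lambda>h. D2u i t x *v h)) (at x)"
    and dF: "\<And>i t x. 0 < t \<Longrightarrow> ((\<lambda>y. A i t y *v Du i t y) has_derivative DF i t x) (at x)"
    and pde: "\<And>i t x. 0 < t \<Longrightarrow> ut i t x - (\<Sum>\<alpha>\<in>UNIV. DF i t x (axis \<alpha> 1) $ \<alpha>) + q i t x \<bullet> Du i t x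
      = kpp_reaction (Lc t x) (Cc t x) (u t x) i"
    by (rule kpp_solution_derivatives[OF sol]) (rule that)
  obtain dA D where "0 \<le> D" and dA: "\<And>i t x. (A i t has_derivative (\<lambda>h. \<Sum>\<alpha>\<in>UNIV. h$\<alpha> *\<^sub>R dA i t x \<alpha>)) (at x)"
    and growth: "\<And>i t x. 0 \<le> t \<Longrightarrow> t \<le> T' \<Longrightarrow> norm (A i t x) \<le> D * (1 + norm x)"
      "\<And>i t x \<alpha>. 0 \<le> t \<Longrightarrow> t \<le> T' \<Longrightarrow> norm (dA i t x \<alpha>) \<le> D * (1 + norm x)"
      "\<And>i t x. 0 \<le> t \<Longrightarrow> t \<le> T' \<Longrightarrow> norm (q i t x) \<le> D * (1 + norm x)"
    by (rule standing_coefficient_growth[OF standing order_trans[OF \<open>0 \<le> t\<close> \<open>t \<le> T'\<close>]]) (rule that)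
  obtain B where B: "\<And>s y j. 0 \<le> s \<Longrightarrow> s \<le> T' \<Longrightarrow> \<bar>u s y $ j\<bar> \<le> B"
    by (rule kpp_solution_bounded_strip[OF sol]) (rule that)
  have "{0..T'} \<noteq> {}" using \<open>0 \<le> t\<close> \<open>t \<le> T'\<close> by simp
  then obtain m where m: "\<And>s. 0 \<le> s \<Longrightarrow> s \<le> T' \<Longrightarrow> m \<le> \<phi> s"
    using continuous_attains_inf[OF compact_Icc _ \<phi>_cont] by (metis atLeastAtMost_iff)
  define v where "v s y = (\<chi> j. \<sigma> * u s y $ j - \<phi> s)" for s y
  have "v t x $ i \<le> 0"
  proof (rule parabolic_system_max_principle[where v = v and vt = "\<lambda>i s y. \<sigma> * ut i s y - \<phi>' s"
        and Dv = "\<lambda>i s y. \<sigma> *\<^sub>R Du i s y" and D2v = "\<lambda>i s y. \<sigma> *\<^sub>R D2u i s y"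
        and DF = "\<lambda>i s y h. \<sigma> *\<^sub>R DF i s y h" and A = A and dA = dA and q = q and \<beta> = \<beta>
        and B = "\<bar>\<sigma>\<bar> * B - m" and D = D and T = T'])
    show "continuous_on ({0..T'} \<times> UNIV) (\<lambda>p. v (fst p) (snd p) $ j)" for j
      unfolding v_def vec_lambda_beta
      by (intro continuous_intros kpp_solution_continuous[OF sol]
          continuous_on_compose2[OF \<phi>_cont continuous_on_fst]) auto
    show "v s y $ j \<le> \<bar>\<sigma>\<bar> * B - m" if "0 \<le> s" "s \<le> T'" for s y j
    proof -
      have "\<sigma> * u s y $ j \<le> \<bar>\<sigma>\<bar> * \<bar>u s y $ j\<bar>" by (metis abs_ge_self abs_mult)
      also have "\<dots> \<le> \<bar>\<sigma>\<bar> * B" using B[OF that] by (rule mult_left_mono) simp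
      finally show ?thesis using m[OF that] by (simp add: v_def)
    qed
    show "v 0 y $ j \<le> 0" for y j
      using init[of y j] by (simp add: v_def kpp_solution_initial[OF sol])
    show "((\<lambda>r. v r y $ j) has_real_derivative \<sigma> * ut j s y - \<phi>' s) (at s)" if "0 < s" "s \<le> T'" for j s y
      unfolding v_def using dt[OF that(1)] \<phi>_deriv[OF that] by (auto intro!: derivative_eq_intros)
    show "((\<lambda>z. v s z $ j) has_derivative (\<lambda>h. (\<sigma> *\<^sub>R Du j s y) \<bullet> h)) (at y)" if "0 < s" for j s y
      unfolding v_def vec_lambda_beta
      by (rule has_derivative_eq_rhs[OF has_derivative_diff[OF has_derivative_mult_right[OF dx[OF that]]
          has_derivative_const]]) (simp add: fun_eq_iff)
    show "((\<lambda>z. \<sigma> *\<^sub>R Du j s z) has_derivative (\<lambda>h. (\<sigma> *\<^sub>R D2u j s y) *v h)) (at y)" if "0 < s" for j s y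
      using has_derivative_scaleR_right[OF dxx[OF that]] by (simp add: scaleR_matrix_vector_assoc)
    show "((\<lambda>z. A j s z *v (\<sigma> *\<^sub>R Du j s z)) has_derivative (\<lambda>h. \<sigma> *\<^sub>R DF j s y h)) (at y)" if "0 < s" for j s y
      using has_derivative_scaleR_right[OF dF[OF that]] by (simp add: matrix_vector_mult_scaleR)
    show "\<sigma> * ut j s y - \<phi>' s - (\<Sum>\<alpha>\<in>UNIV. (\<sigma> *\<^sub>R DF j s y (axis \<alpha> 1)) $ \<alpha>)
        + q j s y \<bullet> (\<sigma> *\<^sub>R Du j s y) \<le> \<beta> * v s y $ j"
      if "0 < s" "s \<le> T'" "0 < v s y $ j" "\<forall>k. v s y $ k \<le> v s y $ j" for j s y
    proof -
      have "\<sigma> * ut j s y - \<phi>' s - (\<Sum>\<alpha>\<in>UNIV. (\<sigma> *\<^sub>R DF j s y (axis \<alpha> 1)) $ \<alpha>)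
          + q j s y \<bullet> (\<sigma> *\<^sub>R Du j s y)
          = \<sigma> * (ut j s y - (\<Sum>\<alpha>\<in>UNIV. DF j s y (axis \<alpha> 1) $ \<alpha>) + q j s y \<bullet> Du j s y) - \<phi>' s"
        by (simp add: sum_distrib_left algebra_simps)
      also have "\<dots> = \<sigma> * kpp_reaction (Lc s y) (Cc s y) (u s y) j - \<phi>' s" by (simp add: pde[OF that(1)])
      also have "\<dots> \<le> \<beta> * (\<sigma> * u s y $ j - \<phi> s)" using that by (intro sub) (auto simp: v_def)
      finally show ?thesis by (simp add: v_def)
    qed
  qed (use dA standing_symmetric[OF standing] standing_psd[OF standing] \<open>0 \<le> D\<close> growth \<open>0 \<le> t\<close> \<open>t \<le> T'\<close>
      in auto)
  then show ?thesis by (simp add: v_def)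
qed

lemma kpp_solution_nonneg:
  fixes T :: real and L :: "real^'n"
    and A :: "'k::finite \<Rightarrow> real \<Rightarrow> real^'n \<Rightarrow> real^'n^'n"
    and q :: "'k \<Rightarrow> real \<Rightarrow> real^'n \<Rightarrow> real^'n"
    and Lc Cc :: "real \<Rightarrow> real^'n \<Rightarrow> real^'k^'k"
    and u0 :: "real^'n \<Rightarrow> real^'k" and u :: "real \<Rightarrow> real^'n \<Rightarrow> real^'k"
  assumes standing: "standing_assumptions T L A q Lc Cc" and sol: "kpp_solution A q Lc Cc u0 u"
    and u0_nonneg: "\<And>y j. 0 \<le> u0 y $ j" and "0 \<le> t"
  shows "0 \<le> u t x $ i"
proof -
  obtain Lb Cb c0 where Lb: "\<And>t x i j. Lc t x $ i $ j \<le> Lb"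
    and Cc: "\<And>t x i j. 0 \<le> Cc t x $ i $ j" "\<And>t x i j. Cc t x $ i $ j \<le> Cb"
    by (rule standing_reaction_bounds[OF standing]) (rule that)
  obtain B where B: "\<And>s y j. 0 \<le> s \<Longrightarrow> s \<le> t \<Longrightarrow> \<bar>u s y $ j\<bar> \<le> B"
    by (rule kpp_solution_bounded_strip[OF sol]) (rule that)
  let ?N = "real CARD('k)"
  have "(- 1) * u t x $ i \<le> 0"
  proof (rule kpp_comparison[OF standing sol, where \<phi> = "\<lambda>_. 0" and \<phi>' = "\<lambda>_. 0" and T' = t
        and \<beta> = "?N * Lb + ?N * Cb * B"])
    show "- 1 * kpp_reaction (Lc s y) (Cc s y) (u s y) j - 0 \<le> (?N * Lb + ?N * Cb * B) * (- 1 * u s y $ j - 0)"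
      if "0 < s" "s \<le> t" "0 < - 1 * u s y $ j" "\<forall>k. - 1 * u s y $ k \<le> - 1 * u s y $ j" for s y j
    proof -
      have "(?N * Lb + ?N * Cb * B) * u s y $ j \<le> kpp_reaction (Lc s y) (Cc s y) (u s y) j"
        by (rule kpp_reaction_lower_bound)
          (use standing_offdiag[OF standing] Lb Cc that B[of s y j] in \<open>auto simp: abs_le_iff\<close>)
      then show ?thesis by simp
    qed
  qed (use u0_nonneg \<open>0 \<le> t\<close> in auto)
  then show ?thesis by simp
qed

lemma kpp_solution_le_logistic:
  fixes T :: real and L :: "real^'n"
    and A :: "'k::finite \<Rightarrow> real \<Rightarrow> real^'n \<Rightarrow> real^'n^'n"
    and q :: "'k \<Rightarrow> real \<Rightarrow> real^'n \<Rightarrow> real^'n"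
    and Lc Cc :: "real \<Rightarrow> real^'n \<Rightarrow> real^'k^'k"
    and u0 :: "real^'n \<Rightarrow> real^'k" and u :: "real \<Rightarrow> real^'n \<Rightarrow> real^'k"
  assumes standing: "standing_assumptions T L A q Lc Cc" and sol: "kpp_solution A q Lc Cc u0 u"
    and u0_nonneg: "\<And>y j. 0 \<le> u0 y $ j"
    and "0 \<le> Lb" and Lb: "\<And>t x i j. Lc t x $ i $ j \<le> Lb"
    and "0 < c0" and Cc: "\<And>t x i j. 0 \<le> Cc t x $ i $ j" "\<And>t x i. c0 \<le> Cc t x $ i $ i"
    and "0 \<le> a" and u0_le: "\<And>y j. u0 y $ j \<le> real CARD('k) * Lb / c0 + a"
    and "0 \<le> t"
  shows "u t x $ i \<le> real CARD('k) * Lb / c0 + a / (1 + c0 * a * t)"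
proof -
  define \<kappa> where "\<kappa> = real CARD('k) * Lb / c0"
  define y where "y s = a / (1 + c0 * a * s)" for s
  have "0 \<le> \<kappa>" using \<open>0 \<le> Lb\<close> \<open>0 < c0\<close> by (simp add: \<kappa>_def)
  have den: "0 < 1 + c0 * a * s" if "0 \<le> s" for s
    using that \<open>0 \<le> a\<close> \<open>0 < c0\<close> by (simp add: add_pos_nonneg)
  have "1 * u t x $ i \<le> \<kappa> + y t"
  proof (rule kpp_comparison[OF standing sol, where \<phi> = "\<lambda>s. \<kappa> + y s" and \<phi>' = "\<lambda>s. - c0 * (y s)\<^sup>2"
        and T' = t and \<beta> = "c0 * \<kappa>"])
    show "continuous_on {0..t} (\<lambda>s. \<kappa> + y s)"
      unfolding y_def using den by (intro continuous_intros) (auto simp: less_imp_neq[symmetric])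
    show "((\<lambda>s. \<kappa> + y s) has_real_derivative - c0 * (y s)\<^sup>2) (at s)" if "0 < s" for s
      using den[of s] that unfolding y_def
      by (auto intro!: derivative_eq_intros simp: power2_eq_square field_simps)
    show "1 * kpp_reaction (Lc s z) (Cc s z) (u s z) j - - c0 * (y s)\<^sup>2 \<le> c0 * \<kappa> * (1 * u s z $ j - (\<kappa> + y s))"
      if "0 < s" "s \<le> t" "\<kappa> + y s < 1 * u s z $ j" "\<forall>k. 1 * u s z $ k \<le> 1 * u s z $ j" for s z j
    proof -
      have "kpp_reaction (Lc s z) (Cc s z) (u s z) j \<le> c0 * \<kappa> * u s z $ j - c0 * (u s z $ j)\<^sup>2"
        using kpp_reaction_upper_bound[OF standing_offdiag[OF standing] Lb Cc(1) Cc(2)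
            kpp_solution_nonneg[OF standing sol u0_nonneg]] that \<open>0 < c0\<close> by (simp add: \<kappa>_def)
      moreover have "0 \<le> y s" using den[of s] that \<open>0 \<le> a\<close> by (simp add: y_def)
      ultimately show ?thesis
        using logistic_supersolution_ineq[OF \<open>0 < c0\<close> \<open>0 \<le> \<kappa>\<close>, of "y s" "u s z $ j"] that by simp
    qed
  qed (use u0_le \<open>0 \<le> t\<close> in \<open>auto simp: \<kappa>_def y_def\<close>)
  then show ?thesis by (simp add: \<kappa>_def y_def)
qed

lemma component_le_SUP_Max:
  fixes u0 :: "'a \<Rightarrow> real^'k::finite"
  assumes "bounded (range u0)"
  shows "u0 y $ j \<le> (SUP y. Max (range (\<lambda>j. u0 y $ j)))"
proof -
  obtain B where B: "\<And>y. norm (u0 y) \<le> B" using assms unfolding bounded_iff by blast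
  have "bdd_above (range (\<lambda>y. Max (range (\<lambda>j. u0 y $ j))))"
  proof (rule bdd_aboveI2)
    fix y
    have "u0 y $ j \<le> B" for j
      using B[of y] component_le_norm_cart[of "u0 y" j] by (meson abs_ge_self order_trans)
    then show "Max (range (\<lambda>j. u0 y $ j)) \<le> B" by simp
  qed
  moreover have "u0 y $ j \<le> Max (range (\<lambda>j. u0 y $ j))" by (rule Max_ge) auto
  ultimately show ?thesis by (meson cSUP_upper2 UNIV_I)
qed

lemma kpp_solution_upper_bounds:
  fixes T :: real and L :: "real^'n"
    and A :: "'k::finite \<Rightarrow> real \<Rightarrow> real^'n \<Rightarrow> real^'n^'n"
    and q :: "'k \<Rightarrow> real \<Rightarrow> real^'n \<Rightarrow> real^'n"
    and Lc Cc :: "real \<Rightarrow> real^'n \<Rightarrow> real^'k^'k"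
    and u0 :: "real^'n \<Rightarrow> real^'k" and u :: "real \<Rightarrow> real^'n \<Rightarrow> real^'k"
  assumes standing: "standing_assumptions T L A q Lc Cc" and sol: "kpp_solution A q Lc Cc u0 u"
    and "bounded (range u0)" and u0_nonneg: "\<And>y j. 0 \<le> u0 y $ j"
    and "0 \<le> Lb" and Lb: "\<And>t x i j. Lc t x $ i $ j \<le> Lb"
    and "0 < c0" and Cc: "\<And>t x i j. 0 \<le> Cc t x $ i $ j" "\<And>t x i. c0 \<le> Cc t x $ i $ i"
  defines "K \<equiv> real CARD('k) * Lb / c0 + 1"
  shows "0 \<le> t \<Longrightarrow> u t x $ i \<le> K + (SUP y. Max (range (\<lambda>j. u0 y $ j)))"
    and "Limsup at_top (\<lambda>t. ereal (SUP x. Max (range (\<lambda>i. u t x $ i)))) \<le> ereal K"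
proof -
  define \<kappa> where "\<kappa> = real CARD('k) * Lb / c0"
  define m where "m = (SUP y. Max (range (\<lambda>j. u0 y $ j)))"
  define a where "a = max (m - \<kappa>) 0"
  have u0_le_m: "u0 y $ j \<le> m" for y j
    unfolding m_def using component_le_SUP_Max[OF \<open>bounded (range u0)\<close>] .
  have "0 \<le> m" using u0_nonneg u0_le_m order_trans by blast
  have "0 \<le> \<kappa>" using \<open>0 \<le> Lb\<close> \<open>0 < c0\<close> by (simp add: \<kappa>_def)
  with \<open>0 \<le> m\<close> have "0 \<le> a" and "a \<le> m" and "m \<le> \<kappa> + a" by (auto simp: a_def)
  have bound: "u t x $ i \<le> \<kappa> + a / (1 + c0 * a * t)" if "0 \<le> t" for t x i
    unfolding \<kappa>_def
    by (rule kpp_solution_le_logistic[OF standing sol u0_nonneg \<open>0 \<le> Lb\<close> Lb \<open>0 < c0\<close> Cc \<open>0 \<le> a\<close>])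
      (use u0_le_m \<open>m \<le> \<kappa> + a\<close> that in \<open>auto simp: \<kappa>_def intro: order_trans\<close>)
  have decay: "a / (1 + c0 * a * t) \<le> b" if "0 \<le> t" "a \<le> b * (1 + c0 * a * t)" for t b
    using that \<open>0 \<le> a\<close> \<open>0 < c0\<close> by (simp add: divide_le_eq add_pos_nonneg)
  show "u t x $ i \<le> K + (SUP y. Max (range (\<lambda>j. u0 y $ j)))" if "0 \<le> t"
  proof -
    have "a \<le> a * (1 + c0 * a * t)" using \<open>0 \<le> a\<close> \<open>0 < c0\<close> that by (simp add: algebra_simps)
    from decay[OF that this] bound[OF that, of x i] \<open>a \<le> m\<close> show ?thesis
      by (simp add: K_def \<kappa>_def m_def)
  qed
  show "Limsup at_top (\<lambda>t. ereal (SUP x. Max (range (\<lambda>i. u t x $ i)))) \<le> ereal K"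
  proof (rule Limsup_bounded, unfold eventually_at_top_linorder, intro exI allI impI)
    fix t assume "1 / c0 \<le> t"
    moreover have "0 < 1 / c0" using \<open>0 < c0\<close> by simp
    ultimately have "0 \<le> t" by linarith
    from \<open>1 / c0 \<le> t\<close> \<open>0 < c0\<close> have "1 \<le> c0 * t" by (simp add: field_simps)
    then have "a \<le> 1 * (1 + c0 * a * t)"
      using \<open>0 \<le> a\<close> mult_left_mono[OF \<open>1 \<le> c0 * t\<close> \<open>0 \<le> a\<close>] by (simp add: algebra_simps)
    then have "u t x $ i \<le> K" for x i using bound[OF \<open>0 \<le> t\<close>, of x i] decay[OF \<open>0 \<le> t\<close>, of 1]
      by (simp add: K_def \<kappa>_def)
    then show "ereal (SUP x. Max (range (\<lambda>i. u t x $ i))) \<le> ereal K"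
      by (simp add: cSUP_least)
  qed
qed

theorem proposition2p1:
  fixes T :: real and L :: "real^'n"
    and A :: "'k::finite \<Rightarrow> real \<Rightarrow> real^'n \<Rightarrow> real^'n^'n"
    and q :: "'k \<Rightarrow> real \<Rightarrow> real^'n \<Rightarrow> real^'n"
    and Lc Cc :: "real \<Rightarrow> real^'n \<Rightarrow> real^'k^'k"
  assumes "standing_assumptions T L A q Lc Cc"
  shows "\<exists>K>0. \<forall>(u0 :: real^'n \<Rightarrow> real^'k) (u :: real \<Rightarrow> real^'n \<Rightarrow> real^'k).
           bounded (range u0) \<and> continuous_on UNIV u0 \<and> (\<forall>y j. u0 y $ j \<ge> 0) \<and>
           kpp_solution A q Lc Cc u0 u \<longrightarrow>
             (\<forall>i t x. t \<ge> 0 \<longrightarrow> u t x $ i \<le> K + (SUP y. Max (range (\<lambda>j. u0 y $ j)))) \<and>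
             Limsup at_top (\<lambda>t. ereal (SUP x. Max (range (\<lambda>i. u t x $ i)))) \<le> ereal K"
proof -
  obtain Lb Cb c0 where "0 \<le> Lb" "0 < c0" and Lb: "\<And>t x i j. Lc t x $ i $ j \<le> Lb"
    and Cc: "\<And>t x i j. 0 \<le> Cc t x $ i $ j" "\<And>t x i. c0 \<le> Cc t x $ i $ i"
    by (rule standing_reaction_bounds[OF assms]) (rule that)
  note bounds = kpp_solution_upper_bounds[OF assms _ _ _ \<open>0 \<le> Lb\<close> Lb \<open>0 < c0\<close> Cc]
  show ?thesis
  proof (intro exI conjI allI impI)
    show "0 < real CARD('k) * Lb / c0 + 1" using \<open>0 \<le> Lb\<close> \<open>0 < c0\<close> by (simp add: add_nonneg_pos)
  qed (use bounds in auto)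
qed

end
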